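(* Let $F$ be a field of characteristic $\neq 2$. The dimension over $F$ of $\mathfrak{K}_{r,s}$ is given as follows. 1) If $r\ge 3$ and $s\ge 3$, then $$\dim\mathfrak{K}_{r,s}=2^{r+s-2}-2^{\frac{r+s-1}{2}}\cos\left(\tfrac{(r+1)\pi}{4}\right)\cos\left(\tfrac{s\pi}{4}\right)=2^{r+s-2}-2^{\frac{r+s-3}{2}}\left\{\cos\left(\tfrac{(r+s+1)\pi}{4}\right)+\cos\left(\tfrac{(r-s+1)\pi}{4}\right)\right\}.$$ 2) If $r\ge 3$, then a) $\dim\mathfrak{K}_{r,1}=2^{r-1}-2^{\frac{r-1}{2}}\cos\left(\frac{(r+1)\pi}{4}\right)$; b) $\dim\mathfrak{K}_{r,2}=2^{r}$. 3) If $s\ge 3$, then a) $\dim\mathfrak{K}_{1,s}=2^{s-1}$; b) $\dim\mathfrak{K}_{2,s}=2^{s}+2^{\frac{s}{2}}\cos\left(\frac{s\pi}{4}\right)$. 4) $\dim\mathfrak{K}_{1,1}=1$, $\dim\mathfrak{K}_{1,2}=2$, $\dim\mathfrak{K}_{2,1}=3$, $\dim\mathfrak{K}_{2,2}=4$.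
   Context: Let $n=r+s$, let $e_1,\dots,e_n$ be the canonical basis of $F^n$, and let $Q$ be the symmetric bilinear form on $F^n$ with $Q(e_i,e_j)=0$ for $i\ne j$, $Q(e_i,e_i)=1$ for $1\le i\le r$, $Q(e_i,e_i)=-1$ for $r+1\le i\le r+s$. $C\ell(r,s)$ is the Clifford algebra over $F$ of $(F^n,Q)$, with sign convention $v\cdot v=-Q(v,v)1$. Let $c$ be the unique algebra anti-automorphism of $C\ell(r,s)$ with $c(v)=-v$ for $v\in F^n$, and let $\mathfrak{G}_{r,s}=\{\varphi\in C\ell(r,s):c(\varphi)=-\varphi\}$. Let $\beta$ be the algebra automorphism of $C\ell(r,s)$ with $\beta(e_i)=e_i$ for $1\le i\le r$ and $\beta(e_{r+j})=-e_{r+j}$ for $1\le j\le s$; it leaves $\mathfrak{G}_{r,s}$ invariant. $\mathfrak{K}_{r,s}$ is the $+1$ eigenspace of $\beta$ restricted to $\mathfrak{G}_{r,s}$. *)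

theory Defs
  imports Complex_Main "HOL-Algebra.QuotRing" "HOL-Algebra.Embedded_Algebras"
begin

(* F^n, with coordinates 1, ..., n. *)
definition Fvec :: "nat \<Rightarrow> (nat \<Rightarrow> 'f::field) set" where
  "Fvec n = {v. \<forall>i. i \<notin> {1..n} \<longrightarrow> v i = 0}"

definition basis_vec :: "nat \<Rightarrow> nat \<Rightarrow> 'f::field" where
  "basis_vec i = (\<lambda>j. if j = i then 1 else 0)"

definition Qform :: "nat \<Rightarrow> nat \<Rightarrow> (nat \<Rightarrow> 'f::field) \<Rightarrow> (nat \<Rightarrow> 'f) \<Rightarrow> 'f" where
  "Qform r s v w = (\<Sum>i=1..r. v i * w i) - (\<Sum>i=r+1..r+s. v i * w i)"

(* The tensor algebra of F^n.  An element is given by its finitely many nonzero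
   coordinates with respect to the basis of pure tensors of basis vectors: the word
   [i1, ..., ik] over {1..n} stands for the tensor product of e_i1, ..., e_ik, and the
   tensor product of two words is their concatenation. *)
definition tensor_algebra :: "nat \<Rightarrow> (nat list \<Rightarrow> 'f::field) ring" where
  "tensor_algebra n =
    \<lparr>carrier = {p. finite {w. p w \<noteq> 0} \<and> (\<forall>w. p w \<noteq> 0 \<longrightarrow> set w \<subseteq> {1..n})},
     mult = (\<lambda>p q w. \<Sum>k\<le>length w. p (take k w) * q (drop k w)),
     one = (\<lambda>w. if w = [] then 1 else 0),
     zero = (\<lambda>w. 0),
     add = (\<lambda>p q w. p w + q w)\<rparr>"

definition tensor_scalar :: "'f::field \<Rightarrow> nat list \<Rightarrow> 'f" where
  "tensor_scalar a = (\<lambda>w. if w = [] then a else 0)"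

definition tensor_vec :: "(nat \<Rightarrow> 'f::field) \<Rightarrow> nat list \<Rightarrow> 'f" where
  "tensor_vec v = (\<lambda>w. case w of [i] \<Rightarrow> v i | _ \<Rightarrow> 0)"

(* Sign convention: v v = - Q(v,v) 1. *)
definition clifford_ideal :: "nat \<Rightarrow> nat \<Rightarrow> (nat list \<Rightarrow> 'f::field) set" where
  "clifford_ideal r s =
    Idl\<^bsub>tensor_algebra (r + s)\<^esub>
      {tensor_vec v \<otimes>\<^bsub>tensor_algebra (r + s)\<^esub> tensor_vec v
         \<oplus>\<^bsub>tensor_algebra (r + s)\<^esub> tensor_scalar (Qform r s v v) | v. v \<in> Fvec (r + s)}"

definition clifford :: "nat \<Rightarrow> nat \<Rightarrow> (nat list \<Rightarrow> 'f::field) set ring" where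
  "clifford r s = tensor_algebra (r + s) Quot clifford_ideal r s"

definition cl_vec :: "nat \<Rightarrow> nat \<Rightarrow> (nat \<Rightarrow> 'f::field) \<Rightarrow> (nat list \<Rightarrow> 'f) set" where
  "cl_vec r s v = clifford_ideal r s +>\<^bsub>tensor_algebra (r + s)\<^esub> tensor_vec v"

(* The F-algebra structure of the Clifford algebra is given by the structure map
   a |-> a 1; scalar multiplication by a is multiplication by its image. *)
definition cl_scalar :: "nat \<Rightarrow> nat \<Rightarrow> 'f::field \<Rightarrow> (nat list \<Rightarrow> 'f) set" where
  "cl_scalar r s a = clifford_ideal r s +>\<^bsub>tensor_algebra (r + s)\<^esub> tensor_scalar a"

definition cl_homogeneous ::
    "nat \<Rightarrow> nat \<Rightarrow> ((nat list \<Rightarrow> 'f::field) set \<Rightarrow> (nat list \<Rightarrow> 'f) set) \<Rightarrow> bool" where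
  "cl_homogeneous r s f \<longleftrightarrow>
    (\<forall>a. \<forall>x \<in> carrier (clifford r s).
      f (cl_scalar r s a \<otimes>\<^bsub>clifford r s\<^esub> x) = cl_scalar r s a \<otimes>\<^bsub>clifford r s\<^esub> f x)"

definition cl_automorphism ::
    "nat \<Rightarrow> nat \<Rightarrow> ((nat list \<Rightarrow> 'f::field) set \<Rightarrow> (nat list \<Rightarrow> 'f) set) \<Rightarrow> bool" where
  "cl_automorphism r s f \<longleftrightarrow>
    f \<in> ring_iso (clifford r s) (clifford r s) \<and> cl_homogeneous r s f"

(* An isomorphism onto the opposite algebra. *)
definition cl_anti_automorphism ::
    "nat \<Rightarrow> nat \<Rightarrow> ((nat list \<Rightarrow> 'f::field) set \<Rightarrow> (nat list \<Rightarrow> 'f) set) \<Rightarrow> bool" where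
  "cl_anti_automorphism r s f \<longleftrightarrow>
    f \<in> ring_iso (clifford r s) ((clifford r s)\<lparr>mult := (\<lambda>x y. y \<otimes>\<^bsub>clifford r s\<^esub> x)\<rparr>) \<and>
    cl_homogeneous r s f"

(* Uniqueness is among maps on the Clifford algebra, so the value outside the carrier is
   pinned down by extensionality; likewise for cl_beta. *)
definition cl_conj ::
    "nat \<Rightarrow> nat \<Rightarrow> (nat list \<Rightarrow> 'f::field) set \<Rightarrow> (nat list \<Rightarrow> 'f) set" where
  "cl_conj r s = (THE c.
    c \<in> extensional (carrier (clifford r s)) \<and>
    cl_anti_automorphism r s c \<and>
    (\<forall>v \<in> Fvec (r + s). c (cl_vec r s v) = \<ominus>\<^bsub>clifford r s\<^esub> cl_vec r s v))"

definition cl_beta ::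
    "nat \<Rightarrow> nat \<Rightarrow> (nat list \<Rightarrow> 'f::field) set \<Rightarrow> (nat list \<Rightarrow> 'f) set" where
  "cl_beta r s = (THE b.
    b \<in> extensional (carrier (clifford r s)) \<and>
    cl_automorphism r s b \<and>
    (\<forall>i \<in> {1..r}. b (cl_vec r s (basis_vec i)) = cl_vec r s (basis_vec i)) \<and>
    (\<forall>j \<in> {1..s}. b (cl_vec r s (basis_vec (r + j)))
                   = \<ominus>\<^bsub>clifford r s\<^esub> cl_vec r s (basis_vec (r + j))))"

definition frakG :: "nat \<Rightarrow> nat \<Rightarrow> (nat list \<Rightarrow> 'f::field) set set" where
  "frakG r s = {x \<in> carrier (clifford r s). cl_conj r s x = \<ominus>\<^bsub>clifford r s\<^esub> x}"

definition frakK :: "nat \<Rightarrow> nat \<Rightarrow> (nat list \<Rightarrow> 'f::field) set set" where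
  "frakK r s = {x \<in> frakG r s. cl_beta r s x = x}"

(* The subspace E of the Clifford algebra is finite-dimensional over F (identified with
   its image under the structure map), and its dimension is the real number x. *)
definition cl_has_dim :: "nat \<Rightarrow> nat \<Rightarrow> (nat list \<Rightarrow> 'f::field) set set \<Rightarrow> real \<Rightarrow> bool" where
  "cl_has_dim r s E x \<longleftrightarrow>
    (\<exists>d. ring.dimension (clifford r s) d (range (cl_scalar r s)) E \<and> real d = x)"

end

theory Submission
  imports Defs
begin

text \<open>
  The generators of the Clifford algebra act on functions on the finite subsets of \<open>{1..n}\<close> by
  the signed permutations expected from left multiplication on the products \<open>e_A\<close> of generators.
  Applying an element of the tensor algebra to the indicator of the empty set gives its coordinates
  in the \<open>e_A\<close>. Every word reduces modulo the Clifford ideal to a multiple of a strictly increasing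
  word, so this ideal is exactly the kernel of the coordinate map and the \<open>e_A\<close> form a basis of the
  quotient. The maps \<open>c\<close> and \<open>\<beta>\<close> are induced by signed rearrangements of words and are
  diagonal in this basis, with eigenvalues \<open>(-1)^(|A| (|A| + 1) / 2)\<close> and \<open>(-1)^|A \<inter> {r+1..n}|\<close>.
  The dimension is therefore the number of \<open>A\<close> with eigenvalues \<open>-1\<close> and \<open>1\<close>, which a roots of
  unity filter turns into real parts of products of powers of \<open>1 + \<i>\<close> and \<open>1 - \<i>\<close>.
\<close>

section \<open>The tensor algebra\<close>

text \<open>The obstacle is linear independence. The relations show at once that the
  \<open>e_A\<close> span the quotient, but not that the ideal is small enough to keep them
  independent; a module on which the relations hold is needed, and the signed permutations give one
  without assuming any basis. Afterwards equality of classes, eigenvalue conditions and membership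
  in a span all become statements about coefficient functions. Both \<open>cl_conj\<close> and
  \<open>cl_beta\<close> are definite descriptions, so existence and uniqueness are proved before
  anything can be computed with them. The characteristic enters where x = -x must force x = 0. The
  count is made for s at least 1, because the sum of (-1)^|A \<inter> {r+1..n}| over all A is 2^r
  0^s; one formula then covers every case of the theorem, and the cases differ only in which cosine
  has a fixed argument.\<close>

definition single :: "'f::field \<Rightarrow> nat list \<Rightarrow> nat list \<Rightarrow> 'f" where
  "single c u = (\<lambda>w. if w = u then c else 0)"

definition conv :: "(nat list \<Rightarrow> 'f::field) \<Rightarrow> (nat list \<Rightarrow> 'f) \<Rightarrow> nat list \<Rightarrow> 'f" where
  "conv p q = (\<lambda>w. \<Sum>k\<le>length w. p (take k w) * q (drop k w))"

abbreviation tensors :: "nat \<Rightarrow> (nat list \<Rightarrow> 'f::field) set" where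
  "tensors n \<equiv> carrier (tensor_algebra n)"

lemma tensor_algebra_simps [simp]:
  "mult (tensor_algebra n) = conv"
  "one (tensor_algebra n) = single 1 []"
  "zero (tensor_algebra n) = (\<lambda>w. 0)"
  "add (tensor_algebra n) = (\<lambda>p q w. p w + q w)"
  by (simp_all add: tensor_algebra_def conv_def single_def fun_eq_iff)

lemma tensor_scalar_eq: "tensor_scalar a = single a []"
  by (simp add: tensor_scalar_def single_def)

lemma mem_tensors:
  "p \<in> tensors n \<longleftrightarrow> finite {w. p w \<noteq> 0} \<and> (\<forall>w. p w \<noteq> 0 \<longrightarrow> set w \<subseteq> {1..n})"
  by (simp add: tensor_algebra_def)

lemma conv_add_left: "conv (\<lambda>w. p w + q w) t = (\<lambda>w. conv p t w + conv q t w)"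
  by (simp add: conv_def sum.distrib algebra_simps)

lemma conv_add_right: "conv t (\<lambda>w. p w + q w) = (\<lambda>w. conv t p w + conv t q w)"
  by (simp add: conv_def sum.distrib algebra_simps)

lemma conv_scale_left: "conv (\<lambda>w. a * p w) q = (\<lambda>w. a * conv p q w)"
  by (simp add: conv_def sum_distrib_left algebra_simps)

lemma conv_scale_right: "conv p (\<lambda>w. a * q w) = (\<lambda>w. a * conv p q w)"
  by (simp add: conv_def sum_distrib_left algebra_simps)

lemma conv_zero [simp]: "conv (\<lambda>w. 0) q = (\<lambda>w. 0)" "conv p (\<lambda>w. 0) = (\<lambda>w. 0)"
  by (simp_all add: conv_def)

lemma conv_Nil: "conv p q [] = p [] * q []"
  by (simp add: conv_def)

text \<open>Separating the cut before the first letter gives a recursion on the word in which p is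
  replaced by its left quotient by a. The later inductions on words therefore keep p
  arbitrary.\<close>

lemma conv_Cons: "conv p q (a # w) = p [] * q (a # w) + conv (\<lambda>u. p (a # u)) q w"
  by (simp add: conv_def sum.atMost_Suc_shift del: sum.atMost_Suc)

text \<open>Induction on the argument word replaces the reindexing of a double sum: the left
  quotient of \<open>conv p q\<close> is again a convolution plus a multiple of a left quotient of
  q.\<close>

lemma conv_assoc: "conv (conv p q) t = conv p (conv q t)"
proof
  fix w
  show "conv (conv p q) t w = conv p (conv q t) w"
  proof (induction w arbitrary: p)
    case Nil
    then show ?case by (simp add: conv_Nil)
  next
    case (Cons a w)
    show ?case
      by (simp add: conv_Cons[of _ _ a w] conv_Cons[of p q a] conv_Nil conv_add_left
          conv_scale_left Cons.IH) (simp add: conv_Cons algebra_simps)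
  qed
qed

lemma conv_single_left: "conv (single a []) q = (\<lambda>w. a * q w)"
proof
  fix w
  show "conv (single a []) q w = a * q w"
    by (cases w) (simp_all add: conv_Nil conv_Cons single_def)
qed

lemma conv_single_right: "conv p (single a []) = (\<lambda>w. p w * a)"
proof
  fix w
  show "conv p (single a []) w = p w * a"
    by (induction w arbitrary: p) (simp_all add: conv_Nil conv_Cons single_def)
qed

lemma conv_single_single: "conv (single c u) (single d v) = single (c * d) (u @ v)"
proof
  fix w
  show "conv (single c u) (single d v) w = single (c * d) (u @ v) w"
  proof (induction u arbitrary: w)
    case Nil
    then show ?case by (simp add: conv_single_left) (simp add: single_def)
  next
    case (Cons a u)
    have *: "(\<lambda>y. single c (a # u) (b # y)) = (if b = a then single c u else (\<lambda>w. 0))" for b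
      by (auto simp: single_def)
    show ?case
      using Cons by (cases w) (auto simp: conv_Nil conv_Cons *, simp_all add: single_def)
  qed
qed

section \<open>Finitely supported elements and induction on the support\<close>

lemma tensors_zero [simp]: "(\<lambda>w. 0) \<in> tensors n"
  by (simp add: mem_tensors)

lemma tensors_single: "set u \<subseteq> {1..n} \<Longrightarrow> single c u \<in> tensors n"
  by (auto simp: mem_tensors single_def)

lemma tensors_add: "p \<in> tensors n \<Longrightarrow> q \<in> tensors n \<Longrightarrow> (\<lambda>w. p w + q w) \<in> tensors n"
proof -
  assume p: "p \<in> tensors n" and q: "q \<in> tensors n"
  have "{w. p w + q w \<noteq> 0} \<subseteq> {w. p w \<noteq> 0} \<union> {w. q w \<noteq> 0}" by auto
  moreover have "finite ({w. p w \<noteq> 0} \<union> {w. q w \<noteq> 0})"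
    using p q by (simp add: mem_tensors)
  ultimately have "finite {w. p w + q w \<noteq> 0}" by (rule finite_subset)
  moreover have "set w \<subseteq> {1..n}" if "p w + q w \<noteq> 0" for w
  proof -
    have "p w \<noteq> 0 \<or> q w \<noteq> 0" using that by auto
    then show ?thesis using p q unfolding mem_tensors by blast
  qed
  ultimately show ?thesis unfolding mem_tensors by blast
qed

text \<open>Linear statements are reduced to single words by removing one word of the support at a
  time.\<close>

lemma tensors_induct [consumes 1, case_names zero add]:
  assumes "p \<in> tensors n"
    and zero: "P (\<lambda>w. 0)"
    and add: "\<And>p c u. p \<in> tensors n \<Longrightarrow> P p \<Longrightarrow> set u \<subseteq> {1..n} \<Longrightarrow> P (\<lambda>w. p w + single c u w)"
  shows "P p"
proof -
  have "finite W \<Longrightarrow> {w. p w \<noteq> 0} = W \<Longrightarrow> \<forall>w\<in>W. set w \<subseteq> {1..n} \<Longrightarrow> P p" for W p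
  proof (induction W arbitrary: p rule: finite_induct)
    case empty
    then have "p = (\<lambda>w. 0)" by auto
    then show ?case using zero by simp
  next
    case (insert u W)
    let ?q = "p(u := 0)"
    have supp: "{w. ?q w \<noteq> 0} = W" using insert.prems insert.hyps by auto
    then have "P ?q" using insert by blast
    moreover have "?q \<in> tensors n"
      unfolding mem_tensors supp using insert.hyps insert.prems supp by blast
    ultimately have "P (\<lambda>w. ?q w + single (p u) u w)" using insert.prems by (intro add) (simp_all del: fun_upd_apply)
    also have "(\<lambda>w. ?q w + single (p u) u w) = p" by (auto simp: single_def)
    finally show ?case .
  qed
  then show ?thesis using assms(1) unfolding mem_tensors by blast
qed

lemma tensors_conv:
  assumes "p \<in> tensors n" "q \<in> tensors n"
  shows "conv p q \<in> tensors n"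
  using assms(1)
proof (induction rule: tensors_induct)
  case zero
  then show ?case by simp
next
  case (add p c u)
  have "conv (single c u) q \<in> tensors n"
    using assms(2)
  proof (induction rule: tensors_induct)
    case zero
    then show ?case by simp
  next
    case (add q d v)
    then show ?case using \<open>set u \<subseteq> {1..n}\<close>
      by (simp add: conv_add_right conv_single_single tensors_add tensors_single)
  qed
  then show ?case using add by (simp add: conv_add_left tensors_add)
qed

lemma tensors_scale: "p \<in> tensors n \<Longrightarrow> (\<lambda>w. a * p w) \<in> tensors n"
  using tensors_conv[OF tensors_single[of "[]" n a]] by (simp add: conv_single_left)

lemma ring_tensor_algebra: "ring (tensor_algebra n :: (nat list \<Rightarrow> 'f::field) ring)"
proof (rule ringI)
  show "abelian_group (tensor_algebra n :: (nat list \<Rightarrow> 'f) ring)"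
  proof (rule abelian_groupI)
    fix x :: "nat list \<Rightarrow> 'f"
    assume "x \<in> tensors n"
    then have "(\<lambda>w. - 1 * x w) \<in> tensors n" by (rule tensors_scale)
    then show "\<exists>y\<in>tensors n. y \<oplus>\<^bsub>tensor_algebra n\<^esub> x = \<zero>\<^bsub>tensor_algebra n\<^esub>" by force
  qed (simp_all add: tensors_add algebra_simps)
  show "monoid (tensor_algebra n :: (nat list \<Rightarrow> 'f) ring)"
    by (rule monoidI)
      (simp_all add: tensors_conv tensors_single conv_assoc conv_single_left conv_single_right)
qed (simp_all add: conv_add_left conv_add_right)

lemma tensor_uminus:
  assumes "p \<in> tensors n"
  shows "\<ominus>\<^bsub>tensor_algebra n\<^esub> p = (\<lambda>w. - p w)"
proof -
  interpret ring "tensor_algebra n" by (rule ring_tensor_algebra)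
  have "(\<lambda>w. - p w) \<in> tensors n" using tensors_scale[OF assms, of "-1"] by simp
  then show ?thesis using minus_equality[of "\<lambda>w. - p w" p] assms by simp
qed

text \<open>Closure under negatives comes from left multiplication by the scalar -1.\<close>

lemma tensor_idealI:
  fixes J :: "(nat list \<Rightarrow> 'f::field) set"
  assumes "J \<subseteq> tensors n" "(\<lambda>w. 0) \<in> J"
    and "\<And>p q. p \<in> J \<Longrightarrow> q \<in> J \<Longrightarrow> (\<lambda>w. p w + q w) \<in> J"
    and left: "\<And>p q. p \<in> J \<Longrightarrow> q \<in> tensors n \<Longrightarrow> conv q p \<in> J"
    and "\<And>p q. p \<in> J \<Longrightarrow> q \<in> tensors n \<Longrightarrow> conv p q \<in> J"
  shows "ideal J (tensor_algebra n)"
proof (rule idealI)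
  interpret ring "tensor_algebra n" by (rule ring_tensor_algebra)
  show "subgroup J (add_monoid (tensor_algebra n))"
  proof (rule add.subgroupI)
    fix p assume p: "p \<in> J"
    have "conv (single (- 1) []) p \<in> J" using p by (intro left tensors_single) simp_all
    moreover have "p \<in> tensors n" using p assms(1) by blast
    ultimately show "\<ominus>\<^bsub>tensor_algebra n\<^esub> p \<in> J" by (simp add: conv_single_left tensor_uminus)
  qed (use assms in auto)
qed (use assms ring_tensor_algebra in auto)

lemma tensor_vec_mem:
  assumes "v \<in> Fvec n"
  shows "tensor_vec v \<in> tensors n"
proof -
  \<comment> \<open>The rule \<open>remdups_adj.cases\<close> serves only to split words into empty,
    one-letter and longer ones.\<close>
  have supp: "w \<in> (\<lambda>i. [i]) ` {1..n}" if "tensor_vec v w \<noteq> 0" for w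
    using that assms by (cases w rule: remdups_adj.cases) (auto simp: tensor_vec_def Fvec_def intro!: imageI)
  then have "{w. tensor_vec v w \<noteq> 0} \<subseteq> (\<lambda>i. [i]) ` {1..n}" by blast
  then have "finite {w. tensor_vec v w \<noteq> 0}" by (rule finite_subset) simp
  with supp show ?thesis unfolding mem_tensors by fastforce
qed

lemma tensor_vec_basis: "tensor_vec (basis_vec i) = single 1 [i]"
  by (auto simp: tensor_vec_def basis_vec_def single_def split: list.splits)

lemma basis_vec_mem: "i \<in> {1..n} \<Longrightarrow> basis_vec i \<in> Fvec n"
  by (auto simp: basis_vec_def Fvec_def)

section \<open>The action of the generators\<close>

text \<open>This is Q(e_i, e_i), so that \<open>e_i\<close> squares to its negative.\<close>

definition gen_sq :: "nat \<Rightarrow> nat \<Rightarrow> 'f::field" where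
  "gen_sq r i = (if i \<le> r then 1 else - 1)"

text \<open>Symmetric difference with {i}: up to a scalar, \<open>e_i\<close> times
  \<open>e_A\<close> is the basis element of this set.\<close>

definition toggle :: "nat \<Rightarrow> nat set \<Rightarrow> nat set" where
  "toggle i A = (if i \<in> A then A - {i} else insert i A)"

definition lt_sign :: "nat \<Rightarrow> nat set \<Rightarrow> 'f::field" where
  "lt_sign i A = (- 1) ^ card {a\<in>A. a < i}"

text \<open>
  On functions on sets, \<open>cgen r i\<close> is left multiplication by \<open>e_i\<close> on linear combinations of the
  \<open>e_A\<close>: the sign \<open>lt_sign i A\<close> comes from moving \<open>e_i\<close> to its place in \<open>e_A\<close>, and a factor
  \<open>e_i e_i = - Q(e_i, e_i)\<close> appears when \<open>e_i\<close> cancels.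
\<close>

definition cgen :: "nat \<Rightarrow> nat \<Rightarrow> (nat set \<Rightarrow> 'f::field) \<Rightarrow> nat set \<Rightarrow> 'f" where
  "cgen r i f = (\<lambda>A. (if i \<in> A then 1 else - gen_sq r i) * lt_sign i A * f (toggle i A))"

text \<open>The extension of \<open>cgen\<close> to the tensor algebra. With \<open>foldr\<close>
  the first letter of a word acts last, as left multiplication requires.\<close>

definition act :: "nat \<Rightarrow> (nat list \<Rightarrow> 'f::field) \<Rightarrow> (nat set \<Rightarrow> 'f) \<Rightarrow> nat set \<Rightarrow> 'f" where
  "act r p f = (\<lambda>A. \<Sum>w | p w \<noteq> 0. p w * foldr (cgen r) w f A)"

lemma toggle_toggle [simp]: "toggle i (toggle i A) = A"
  by (auto simp: toggle_def)

lemma toggle_commute: "toggle i (toggle j A) = toggle j (toggle i A)"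
  by (auto simp: toggle_def)

lemma mem_toggle: "i \<in> toggle j A \<longleftrightarrow> (i \<in> A) \<noteq> (i = j)"
  by (auto simp: toggle_def)

lemma lt_sign_sq [simp]: "lt_sign i A * lt_sign i A = 1"
  by (simp add: lt_sign_def flip: power_mult_distrib)

text \<open>The counted set lies below i, so it is finite even for infinite A, and toggling j
  changes its size by one exactly when j < i.\<close>

lemma lt_sign_toggle: "lt_sign i (toggle j A) = (if j < i then - 1 else 1) * lt_sign i A"
proof (cases "j < i")
  case True
  show ?thesis
  proof (cases "j \<in> A")
    case j: True
    then have "{a\<in>A. a < i} = insert j {a \<in> toggle j A. a < i}"
      using True by (auto simp: toggle_def)
    moreover have "j \<notin> {a \<in> toggle j A. a < i}" using j by (simp add: mem_toggle)
    ultimately show ?thesis using True by (simp add: lt_sign_def)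
  next
    case j: False
    then have "{a \<in> toggle j A. a < i} = insert j {a\<in>A. a < i}"
      using True by (auto simp: toggle_def)
    then show ?thesis using True j by (simp add: lt_sign_def)
  qed
next
  case False
  then have "{a \<in> toggle j A. a < i} = {a\<in>A. a < i}" by (auto simp: toggle_def)
  then show ?thesis using False by (simp add: lt_sign_def)
qed

text \<open>Exactly one of A and \<open>toggle i A\<close> contains i, so the factor
  \<open>- gen_sq r i\<close> occurs once; the two order signs agree and cancel.\<close>

lemma cgen_cgen: "cgen r i (cgen r i f) = (\<lambda>A. - gen_sq r i * f A)"
proof
  fix A
  have "cgen r i (cgen r i f) A = - gen_sq r i * (lt_sign i A * lt_sign i A) * f A"
    by (cases "i \<in> A") (simp_all add: cgen_def lt_sign_toggle mem_toggle)
  then show "cgen r i (cgen r i f) A = - gen_sq r i * f A" by simp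
qed

text \<open>Toggling one index flips the order sign of the other only if it is the smaller one, so
  exactly one of the two compositions picks up an extra sign.\<close>

lemma cgen_anticommute:
  assumes "i \<noteq> j"
  shows "cgen r i (cgen r j f) = (\<lambda>A. - cgen r j (cgen r i f) A)"
proof
  fix A
  have "j < i \<longleftrightarrow> \<not> i < j" using assms by auto
  then show "cgen r i (cgen r j f) A = - cgen r j (cgen r i f) A"
    using assms by (auto simp: cgen_def lt_sign_toggle mem_toggle toggle_commute[of i j])
qed

lemma cgen_add: "cgen r i (\<lambda>A. f A + g A) = (\<lambda>A. cgen r i f A + cgen r i g A)"
  by (simp add: cgen_def algebra_simps)

lemma cgen_scale: "cgen r i (\<lambda>A. a * f A) = (\<lambda>A. a * cgen r i f A)"
  by (simp add: cgen_def algebra_simps)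

lemma word_add:
  "foldr (cgen r) w (\<lambda>A. f A + g A) = (\<lambda>A. foldr (cgen r) w f A + foldr (cgen r) w g A)"
  by (induction w) (simp_all add: cgen_add)

lemma word_scale: "foldr (cgen r) w (\<lambda>A. a * f A) = (\<lambda>A. a * foldr (cgen r) w f A)"
  by (induction w) (simp_all add: cgen_scale)

lemma word_zero [simp]: "foldr (cgen r) w (\<lambda>A. 0) = (\<lambda>A. 0)"
  by (induction w) (simp_all add: cgen_def)

section \<open>The tensor algebra acts through its generators\<close>

lemma act_superset:
  assumes "finite W" "{w. p w \<noteq> 0} \<subseteq> W"
  shows "act r p f A = (\<Sum>w\<in>W. p w * foldr (cgen r) w f A)"
  unfolding act_def using assms by (intro sum.mono_neutral_left) auto

lemma act_single: "act r (single c u) f = (\<lambda>A. c * foldr (cgen r) u f A)"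
proof
  fix A
  have "act r (single c u) f A = (\<Sum>w\<in>{u}. single c u w * foldr (cgen r) w f A)"
    by (rule act_superset) (auto simp: single_def)
  then show "act r (single c u) f A = c * foldr (cgen r) u f A" by (simp add: single_def)
qed

lemma act_zero [simp]: "act r (\<lambda>w. 0) f = (\<lambda>A. 0)"
  by (simp add: act_def)

lemma act_add:
  assumes "p \<in> tensors n" "q \<in> tensors n"
  shows "act r (\<lambda>w. p w + q w) f = (\<lambda>A. act r p f A + act r q f A)"
proof
  fix A
  let ?W = "{w. p w \<noteq> 0} \<union> {w. q w \<noteq> 0}"
  have "finite ?W" using assms by (simp add: mem_tensors)
  then show "act r (\<lambda>w. p w + q w) f A = act r p f A + act r q f A"
    by (subst (1 2 3) act_superset[of ?W]) (auto simp: sum.distrib algebra_simps)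
qed

lemma act_zero_right [simp]: "act r p (\<lambda>A. 0) = (\<lambda>A. 0)"
  by (simp add: act_def)

lemma act_add_right: "act r p (\<lambda>A. f A + g A) = (\<lambda>A. act r p f A + act r p g A)"
  by (simp add: act_def word_add sum.distrib algebra_simps)

lemma act_scale_right: "act r p (\<lambda>A. a * f A) = (\<lambda>A. a * act r p f A)"
  by (simp add: act_def word_scale sum_distrib_left algebra_simps)

text \<open>By bilinearity two words suffice, and \<open>foldr\<close> over a concatenation is a
  composition.\<close>

lemma act_conv:
  assumes p: "p \<in> tensors n" and q: "q \<in> tensors n"
  shows "act r (conv p q) f = act r p (act r q f)"
  using p
proof (induction rule: tensors_induct)
  case zero
  show ?case by simp
next
  case (add p c u)
  have "act r (conv (single c u) q) f = act r (single c u) (act r q f)"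
    using q
  proof (induction rule: tensors_induct)
    case zero
    show ?case by simp
  next
    case (add q d v)
    have "conv (single c u) q \<in> tensors n" "single (c * d) (u @ v) \<in> tensors n"
      using add \<open>set u \<subseteq> {1..n}\<close> by (simp_all add: tensors_conv tensors_single)
    then have "act r (conv (single c u) (\<lambda>w. q w + single d v w)) f =
        (\<lambda>A. act r (conv (single c u) q) f A + act r (single (c * d) (u @ v)) f A)"
      by (simp add: conv_add_right conv_single_single act_add)
    moreover have "act r (\<lambda>w. q w + single d v w) f =
        (\<lambda>A. act r q f A + d * foldr (cgen r) v f A)"
      using add by (simp add: act_add tensors_single act_single)
    ultimately show ?case
      using add by (simp add: act_add_right act_scale_right) (simp add: act_single algebra_simps)
  qed
  moreover have "act r (conv (\<lambda>w. p w + single c u w) q) f =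
      (\<lambda>A. act r (conv p q) f A + act r (conv (single c u) q) f A)"
    unfolding conv_add_left using add q
    by (intro act_add[of _ n] tensors_conv tensors_single)
  moreover have "act r (\<lambda>w. p w + single c u w) (act r q f) =
      (\<lambda>A. act r p (act r q f) A + act r (single c u) (act r q f) A)"
    using add by (intro act_add[of _ n] tensors_single)
  ultimately show ?case using add by simp
qed

lemma act_tensor_vec:
  assumes "v \<in> Fvec n"
  shows "act r (tensor_vec v) f = (\<lambda>A. \<Sum>i\<in>{1..n}. v i * cgen r i f A)"
proof
  fix A
  have "tensor_vec v w \<noteq> 0 \<Longrightarrow> w \<in> (\<lambda>i. [i]) ` {1..n}" for w
    using assms by (cases w rule: remdups_adj.cases) (auto simp: tensor_vec_def Fvec_def intro!: imageI)
  then have "{w. tensor_vec v w \<noteq> 0} \<subseteq> (\<lambda>i. [i]) ` {1..n}" by blast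
  then have "act r (tensor_vec v) f A =
      (\<Sum>w\<in>(\<lambda>i. [i]) ` {1..n}. tensor_vec v w * foldr (cgen r) w f A)"
    by (intro act_superset) auto
  also have "\<dots> = (\<Sum>i\<in>{1..n}. v i * cgen r i f A)"
    by (subst sum.reindex) (auto simp: inj_on_def tensor_vec_def)
  finally show "act r (tensor_vec v) f A = (\<Sum>i\<in>{1..n}. v i * cgen r i f A)" .
qed

text \<open>Each induction step adds a row and a column that cancel, so no division by 2 is
  made.\<close>

lemma sum_antisymmetric_diagonal:
  fixes g :: "nat \<Rightarrow> nat \<Rightarrow> 'a::comm_ring_1"
  assumes "\<And>i j. i \<noteq> j \<Longrightarrow> g i j = - g j i"
  shows "(\<Sum>i\<in>{1..n}. \<Sum>j\<in>{1..n}. g i j) = (\<Sum>i\<in>{1..n}. g i i)"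
proof (induction n)
  case 0
  show ?case by simp
next
  case (Suc n)
  have "(\<Sum>j\<in>{1..n}. g (Suc n) j) = - (\<Sum>j\<in>{1..n}. g j (Suc n))"
    unfolding sum_negf[symmetric] by (intro sum.cong refl assms) auto
  then show ?case using Suc by (simp add: sum.distrib)
qed

lemma Qform_gen_sq: "Qform r s v v = (\<Sum>i\<in>{1..r+s}. gen_sq r i * (v i * v i))"
proof -
  have "{1..r+s} = {1..r} \<union> {r+1..r+s}" by auto
  then have "(\<Sum>i\<in>{1..r+s}. gen_sq r i * (v i * v i)) =
      (\<Sum>i=1..r. gen_sq r i * (v i * v i)) + (\<Sum>i=r+1..r+s. gen_sq r i * (v i * v i))"
    by (simp add: sum.union_disjoint)
  also have "(\<Sum>i=1..r. gen_sq r i * (v i * v i)) = (\<Sum>i=1..r. v i * v i)"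
    by (rule sum.cong) (auto simp: gen_sq_def)
  also have "(\<Sum>i=r+1..r+s. gen_sq r i * (v i * v i)) = (\<Sum>i=r+1..r+s. - (v i * v i))"
    by (rule sum.cong) (auto simp: gen_sq_def)
  finally show ?thesis by (simp add: Qform_def sum_negf)
qed

lemma cgen_sum: "finite I \<Longrightarrow> cgen r i (\<lambda>A. \<Sum>j\<in>I. g j A) = (\<lambda>A. \<Sum>j\<in>I. cgen r i (g j) A)"
  by (simp add: cgen_def sum_distrib_left)

text \<open>The mixed terms cancel by anticommutation, and the diagonal ones add up to - Q(v,
  v).\<close>

lemma act_tensor_vec_sq:
  assumes "v \<in> Fvec (r + s)"
  shows "act r (conv (tensor_vec v) (tensor_vec v)) f = (\<lambda>A. - Qform r s v v * f A)"
proof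
  fix A
  let ?g = "\<lambda>i j. v i * (v j * cgen r i (cgen r j f) A)"
  have "act r (conv (tensor_vec v) (tensor_vec v)) f A =
      act r (tensor_vec v) (\<lambda>A. \<Sum>i\<in>{1..r+s}. v i * cgen r i f A) A"
    using act_conv[OF tensor_vec_mem tensor_vec_mem, OF assms assms]
    by (simp add: act_tensor_vec[OF assms])
  also have "\<dots> = (\<Sum>i\<in>{1..r+s}. \<Sum>j\<in>{1..r+s}. ?g i j)"
    by (simp add: act_tensor_vec[OF assms] cgen_sum cgen_scale sum_distrib_left)
  also have "\<dots> = (\<Sum>i\<in>{1..r+s}. ?g i i)"
    by (rule sum_antisymmetric_diagonal, subst cgen_anticommute) simp_all
  also have "\<dots> = - Qform r s v v * f A"
    by (simp add: cgen_cgen Qform_gen_sq sum_distrib_left sum_negf mult_ac)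
  finally show "act r (conv (tensor_vec v) (tensor_vec v)) f A = - Qform r s v v * f A" .
qed

section \<open>The Clifford ideal annihilates the module\<close>

definition cl_rels :: "nat \<Rightarrow> nat \<Rightarrow> (nat list \<Rightarrow> 'f::field) set" where
  "cl_rels r s = {(\<lambda>w. conv (tensor_vec v) (tensor_vec v) w + single (Qform r s v v) [] w) |
    v. v \<in> Fvec (r + s)}"

lemma clifford_ideal_eq: "clifford_ideal r s = Idl\<^bsub>tensor_algebra (r + s)\<^esub> cl_rels r s"
  by (simp add: clifford_ideal_def cl_rels_def tensor_scalar_eq)

lemma cl_rels_subset: "cl_rels r s \<subseteq> tensors (r + s)"
  by (auto simp: cl_rels_def intro!: tensors_add tensors_conv tensor_vec_mem tensors_single)

lemma ideal_clifford_ideal: "ideal (clifford_ideal r s) (tensor_algebra (r + s))"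
  unfolding clifford_ideal_eq
  by (rule ring.genideal_ideal[OF ring_tensor_algebra cl_rels_subset])

lemma cl_rels_subset_ideal: "cl_rels r s \<subseteq> clifford_ideal r s"
  unfolding clifford_ideal_eq
  by (rule ring.genideal_self[OF ring_tensor_algebra cl_rels_subset])

lemma clifford_ideal_least:
  "ideal J (tensor_algebra (r + s)) \<Longrightarrow> cl_rels r s \<subseteq> J \<Longrightarrow> clifford_ideal r s \<subseteq> J"
  unfolding clifford_ideal_eq by (rule ring.genideal_minimal[OF ring_tensor_algebra])

text \<open>The annihilator of the module is a two-sided ideal containing the relations. It has to
  kill every f and not just \<open>ind {}\<close>: for closure under right multiplication by q, p is
  applied to \<open>act r q f\<close>.\<close>

lemma act_clifford_ideal:
  fixes p :: "nat list \<Rightarrow> 'f::field"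
  assumes "p \<in> clifford_ideal r s"
  shows "act r p f = (\<lambda>A. 0)"
proof -
  let ?J = "{p :: nat list \<Rightarrow> 'f. p \<in> tensors (r + s) \<and> (\<forall>f. act r p f = (\<lambda>A. 0))}"
  have "ideal ?J (tensor_algebra (r + s))"
    by (rule tensor_idealI)
      (auto simp: act_add[of _ "r + s"] act_conv[of _ "r + s"] tensors_add tensors_conv)
  moreover have "cl_rels r s \<subseteq> ?J"
  proof
    fix p :: "nat list \<Rightarrow> 'f"
    assume p: "p \<in> cl_rels r s"
    then obtain v where v: "v \<in> Fvec (r + s)"
      "p = (\<lambda>w. conv (tensor_vec v) (tensor_vec v) w + single (Qform r s v v) [] w)"
      by (auto simp: cl_rels_def)
    have "act r p f = (\<lambda>A. 0)" for f
      using v(1) unfolding v(2)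
      by (subst act_add[of _ "r + s"])
        (simp_all add: tensors_conv tensor_vec_mem tensors_single act_tensor_vec_sq act_single)
    with p show "p \<in> ?J" using cl_rels_subset by blast
  qed
  ultimately have "clifford_ideal r s \<subseteq> ?J" by (rule clifford_ideal_least)
  with assms show ?thesis by blast
qed

section \<open>Reduction to increasing words\<close>

lemma tensors_diff: "p \<in> tensors n \<Longrightarrow> q \<in> tensors n \<Longrightarrow> (\<lambda>w. p w - q w) \<in> tensors n"
  using tensors_add[of p n "\<lambda>w. - 1 * q w"] tensors_scale[of q n "- 1"] by simp

lemma clifford_ideal_tensors: "p \<in> clifford_ideal r s \<Longrightarrow> p \<in> tensors (r + s)"
  using ideal.Icarr[OF ideal_clifford_ideal] .

lemma clifford_ideal_zero: "(\<lambda>w. 0) \<in> clifford_ideal r s"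
  using additive_subgroup.zero_closed[OF ideal.axioms(1)[OF ideal_clifford_ideal]] by simp

lemma clifford_ideal_add:
  "p \<in> clifford_ideal r s \<Longrightarrow> q \<in> clifford_ideal r s \<Longrightarrow> (\<lambda>w. p w + q w) \<in> clifford_ideal r s"
  using additive_subgroup.a_closed[OF ideal.axioms(1)[OF ideal_clifford_ideal], of p r s q] by simp

lemma clifford_ideal_conv_left:
  "p \<in> clifford_ideal r s \<Longrightarrow> q \<in> tensors (r + s) \<Longrightarrow> conv q p \<in> clifford_ideal r s"
  using ideal.I_l_closed[OF ideal_clifford_ideal, of p r s q] by simp

lemma clifford_ideal_conv_right:
  "p \<in> clifford_ideal r s \<Longrightarrow> q \<in> tensors (r + s) \<Longrightarrow> conv p q \<in> clifford_ideal r s"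
  using ideal.I_r_closed[OF ideal_clifford_ideal, of p r s q] by simp

lemma clifford_ideal_scale: "p \<in> clifford_ideal r s \<Longrightarrow> (\<lambda>w. a * p w) \<in> clifford_ideal r s"
  using clifford_ideal_conv_left[of p r s "single a []"]
  by (simp add: tensors_single conv_single_left)

lemma clifford_ideal_diff:
  "p \<in> clifford_ideal r s \<Longrightarrow> q \<in> clifford_ideal r s \<Longrightarrow> (\<lambda>w. p w - q w) \<in> clifford_ideal r s"
  using clifford_ideal_add[of p r s "\<lambda>w. - 1 * q w"] clifford_ideal_scale[of q r s "- 1"] by simp

section \<open>Coordinates of increasing and of reversed words\<close>

definition ind :: "'a set \<Rightarrow> 'a set \<Rightarrow> 'f::field" where
  "ind B = (\<lambda>A. if A = B then 1 else 0)"

definition coord :: "nat \<Rightarrow> (nat list \<Rightarrow> 'f::field) \<Rightarrow> nat set \<Rightarrow> 'f" where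
  "coord r p = act r p (ind {})"

lemma coord_single: "coord r (single c u) = (\<lambda>A. c * foldr (cgen r) u (ind {}) A)"
  by (simp add: coord_def act_single)

lemma coord_add:
  "p \<in> tensors n \<Longrightarrow> q \<in> tensors n \<Longrightarrow> coord r (\<lambda>w. p w + q w) = (\<lambda>A. coord r p A + coord r q A)"
  by (simp add: coord_def act_add)

lemma coord_scale:
  assumes "p \<in> tensors n"
  shows "coord r (\<lambda>w. a * p w) = (\<lambda>A. a * coord r p A)"
  using act_conv[of "single a []" n p r "ind {}"] assms
  by (simp add: coord_def tensors_single conv_single_left act_single)

lemma coord_diff:
  "p \<in> tensors n \<Longrightarrow> q \<in> tensors n \<Longrightarrow> coord r (\<lambda>w. p w - q w) = (\<lambda>A. coord r p A - coord r q A)"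
  using coord_add[of p n "\<lambda>w. - 1 * q w" r] tensors_scale[of q n "- 1"] coord_scale[of q n r "- 1"] by simp

lemma coord_clifford_ideal: "p \<in> clifford_ideal r s \<Longrightarrow> coord r p = (\<lambda>A. 0)"
  by (simp add: coord_def act_clifford_ideal)

lemma coord_cong:
  assumes "(\<lambda>w. p w - q w) \<in> clifford_ideal r s" "p \<in> tensors (r + s)" "q \<in> tensors (r + s)"
  shows "coord r p = coord r q"
  using coord_clifford_ideal[OF assms(1)] coord_diff[OF assms(2,3), of r] by (simp add: fun_eq_iff)

text \<open>No element of \<open>insert i B\<close> is below i, so the sign is trivial, and i is not
  in B, so nothing cancels.\<close>

lemma cgen_ind_less:
  assumes "\<And>j. j \<in> B \<Longrightarrow> i < j"
  shows "cgen r i (ind B) = (ind (insert i B) :: nat set \<Rightarrow> 'f::field)"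
proof
  fix A
  have iB: "i \<notin> B" using assms by blast
  have "toggle i A = B \<longleftrightarrow> A = toggle i B" by auto
  then have *: "toggle i A = B \<longleftrightarrow> A = insert i B" using iB by (simp add: toggle_def)
  show "cgen r i (ind B) A = (ind (insert i B) A :: 'f)"
  proof (cases "A = insert i B")
    case True
    have "{a\<in>A. a < i} = {}" using assms True by force
    then have "lt_sign i A = (1 :: 'f)" by (simp only: lt_sign_def) simp
    then show ?thesis using True * by (simp add: cgen_def ind_def)
  qed (use * in \<open>simp add: cgen_def ind_def\<close>)
qed

text \<open>The letters act from the largest to the smallest, each below all those already present.
  Distinct increasing words thus get distinct indicators, which is the linear independence of the
  \<open>e_A\<close>.\<close>

lemma foldr_cgen_sorted:
  "sorted_wrt (<) w \<Longrightarrow> foldr (cgen r) w (ind {}) = ind (set w)"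
  by (induction w) (simp_all add: cgen_ind_less)

lemma coord_single_sorted: "sorted_wrt (<) w \<Longrightarrow> coord r (single c w) = (\<lambda>A. c * ind (set w) A)"
  by (simp add: coord_single foldr_cgen_sorted)

lemma foldr_cgen_anticommute:
  "i \<notin> set w \<Longrightarrow>
    foldr (cgen r) w (cgen r i f) = (\<lambda>A. (- 1) ^ length w * cgen r i (foldr (cgen r) w f) A)"
proof (induction w)
  case (Cons j w)
  then have "foldr (cgen r) (j # w) (cgen r i f) =
      (\<lambda>A. (- 1) ^ length w * cgen r j (cgen r i (foldr (cgen r) w f)) A)"
    by (simp add: cgen_scale)
  also have "cgen r j (cgen r i (foldr (cgen r) w f)) = (\<lambda>A. - cgen r i (cgen r j (foldr (cgen r) w f)) A)"
    using Cons by (intro cgen_anticommute) auto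
  finally show ?case by simp
qed simp

text \<open>In the reversed word the smallest generator acts first; moving it past the others costs
  \<open>length w\<close> signs, and these add up to the binomial coefficient.\<close>

lemma foldr_cgen_rev:
  "sorted_wrt (<) w \<Longrightarrow>
    foldr (cgen r) (rev w) (ind {}) =
      (\<lambda>A. (- 1) ^ (length w choose 2) * ind (set w) A :: 'f::field)"
proof (induction w)
  case (Cons i w)
  have "foldr (cgen r) (rev (i # w)) (ind {}) =
      (\<lambda>A. (- 1) ^ length w * cgen r i (foldr (cgen r) (rev w) (ind {})) A :: 'f)"
    using Cons.prems foldr_cgen_anticommute[of i "rev w" r "ind {}"] by auto
  also have "\<dots> = (\<lambda>A. (- 1) ^ (length w + (length w choose 2)) * ind (set (i # w)) A)"
    using Cons by (simp add: cgen_scale cgen_ind_less power_add mult.assoc)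
  also have "length w + (length w choose 2) = length (i # w) choose 2"
    by (simp add: numeral_2_eq_2)
  finally show ?case .
qed (simp add: numeral_2_eq_2)

section \<open>Rewriting words modulo the ideal\<close>

lemma clifford_rel:
  "v \<in> Fvec (r + s) \<Longrightarrow>
    (\<lambda>w. conv (tensor_vec v) (tensor_vec v) w + single (Qform r s v v) [] w) \<in> clifford_ideal r s"
  using cl_rels_subset_ideal unfolding cl_rels_def by blast

lemma clifford_rel_sq:
  assumes i: "i \<in> {1..r + s}"
  shows "(\<lambda>w. single 1 [i, i] w + single (gen_sq r i) [] w :: 'f::field) \<in> clifford_ideal r s"
proof -
  have "Qform r s (basis_vec i) (basis_vec i) = (gen_sq r i :: 'f)"
    using i by (simp add: Qform_gen_sq basis_vec_def if_distrib cong: if_cong)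
  then show ?thesis
    using clifford_rel[of "basis_vec i :: nat \<Rightarrow> 'f", OF basis_vec_mem[OF i]] by (simp add: tensor_vec_basis conv_single_single)
qed

text \<open>Polarization: from the relation of e_i + e_j subtract those of e_i and e_j. The values
  of Q cancel because the two vectors are orthogonal.\<close>

lemma clifford_rel_anticommute:
  assumes i: "i \<in> {1..r + s}" and j: "j \<in> {1..r + s}" and "i \<noteq> j"
  shows "(\<lambda>w. single 1 [i, j] w + single 1 [j, i] w :: 'f::field) \<in> clifford_ideal r s"
proof -
  let ?v = "\<lambda>k. basis_vec i k + basis_vec j k :: 'f"
  let ?q = "\<lambda>v :: nat \<Rightarrow> 'f. Qform r s v v"
  have v: "?v \<in> Fvec (r + s)"
    using i j by (auto simp: Fvec_def basis_vec_def)
  have "?q ?v = (\<Sum>k\<in>{1..r+s}. gen_sq r k * (basis_vec i k * basis_vec i k) +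
      gen_sq r k * (basis_vec j k * basis_vec j k))"
    unfolding Qform_gen_sq using \<open>i \<noteq> j\<close> by (intro sum.cong) (auto simp: basis_vec_def)
  then have q: "?q ?v = ?q (basis_vec i) + ?q (basis_vec j)"
    by (simp add: Qform_gen_sq sum.distrib)
  have vec: "tensor_vec ?v = (\<lambda>w. single 1 [i] w + single 1 [j] w)"
    by (auto simp: tensor_vec_def single_def basis_vec_def fun_eq_iff split: list.splits)
  note rel = clifford_rel[OF v] clifford_rel[OF basis_vec_mem[OF i]] clifford_rel[OF basis_vec_mem[OF j]]
  have "(\<lambda>w. conv (tensor_vec ?v) (tensor_vec ?v) w + single (?q ?v) [] w -
      (conv (tensor_vec (basis_vec i)) (tensor_vec (basis_vec i)) w + single (?q (basis_vec i)) [] w) -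
      (conv (tensor_vec (basis_vec j)) (tensor_vec (basis_vec j)) w + single (?q (basis_vec j)) [] w))
      \<in> clifford_ideal r s" (is "?p \<in> _")
    by (intro clifford_ideal_diff rel)
  also have "?p = (\<lambda>w. single 1 [i, j] w + single 1 [j, i] w)"
    unfolding vec q tensor_vec_basis conv_add_left conv_add_right conv_single_single
    by (simp add: fun_eq_iff) (simp add: single_def)
  finally show ?thesis .
qed

text \<open>One step of insertion sort. The bound on \<open>set v\<close> is what keeps
  \<open>a # v\<close> increasing after a swap, since a lies below i and below all of u.\<close>

lemma insert_sorted_word:
  assumes i: "i \<in> {1..r + s}"
  shows "sorted_wrt (<) u \<Longrightarrow> set u \<subseteq> {1..r + s} \<Longrightarrow>
    \<exists>(c :: 'f::field) v. sorted_wrt (<) v \<and> set v \<subseteq> insert i (set u) \<and>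
      (\<lambda>w. single 1 (i # u) w - single c v w) \<in> clifford_ideal r s"
proof (induction u)
  case Nil
  have "(\<lambda>w. single 1 [i] w - single 1 [i] w :: 'f) \<in> clifford_ideal r s"
    by (simp add: clifford_ideal_zero)
  then show ?case by (intro exI[of _ 1] exI[of _ "[i]"]) simp
next
  case (Cons a u)
  have u: "(single 1 u :: nat list \<Rightarrow> 'f) \<in> tensors (r + s)" using Cons.prems by (simp add: tensors_single)
  consider "i < a" | "i = a" | "a < i" by linarith
  then show ?case
  proof cases
    case 1
    have "(\<lambda>w. single 1 (i # a # u) w - single 1 (i # a # u) w :: 'f) \<in> clifford_ideal r s"
      by (simp add: clifford_ideal_zero)
    then show ?thesis
      using 1 Cons.prems by (intro exI[of _ 1] exI[of _ "i # a # u"]) auto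
  next
    case 2
    have "(\<lambda>w. single 1 (i # a # u) w - single (- gen_sq r i) u w :: 'f) =
        conv (\<lambda>w. single 1 [i, i] w + single (gen_sq r i) [] w) (single 1 u)"
      using 2 by (simp add: conv_add_left conv_single_single fun_eq_iff) (simp add: single_def)
    then have "(\<lambda>w. single 1 (i # a # u) w - single (- gen_sq r i) u w :: 'f) \<in> clifford_ideal r s"
      using clifford_ideal_conv_right[OF clifford_rel_sq[OF i] u] by simp
    then show ?thesis
      using Cons.prems by (intro exI[of _ "- gen_sq r i"] exI[of _ u]) auto
  next
    case 3
    obtain c :: 'f and v where v: "sorted_wrt (<) v" "set v \<subseteq> insert i (set u)"
      and cv: "(\<lambda>w. single 1 (i # u) w - single c v w) \<in> clifford_ideal r s"
      using Cons by auto
    have a: "a \<in> {1..r + s}" using Cons.prems by simp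
    \<comment> \<open>Swap i with a at the price of a sign, then multiply the inductive congruence
      by \<open>e_a\<close> on the left; hence the coefficient - c. The difference is written with a
      factor -1 so that the sum and scalar rules for \<open>conv\<close> apply.\<close>
    have "conv (\<lambda>w. single 1 [i, a] w + single 1 [a, i] w :: 'f) (single 1 u) \<in> clifford_ideal r s"
      using 3 by (intro clifford_ideal_conv_right[OF clifford_rel_anticommute[OF i a] u]) simp
    moreover have "conv (single 1 [a]) (\<lambda>w. single 1 (i # u) w + (- 1) * single c v w) \<in> clifford_ideal r s"
      using a cv by (intro clifford_ideal_conv_left tensors_single) auto
    ultimately have "(\<lambda>w. conv (\<lambda>w. single 1 [i, a] w + single 1 [a, i] w) (single 1 u) w -
        conv (single 1 [a]) (\<lambda>w. single 1 (i # u) w + (- 1) * single c v w) w) \<in> clifford_ideal r s"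
      by (rule clifford_ideal_diff)
    also have "(\<lambda>w. conv (\<lambda>w. single 1 [i, a] w + single 1 [a, i] w) (single 1 u) w -
        conv (single 1 [a]) (\<lambda>w. single 1 (i # u) w + (- 1) * single c v w) w) =
        (\<lambda>w. single 1 (i # a # u) w - single (- c) (a # v) w)"
      unfolding conv_add_left conv_add_right conv_scale_right conv_single_single
      by (simp add: fun_eq_iff) (simp add: single_def)
    finally show ?thesis
      using Cons.prems v 3 by (intro exI[of _ "- c"] exI[of _ "a # v"]) auto
  qed
qed

lemma sort_word:
  "set u \<subseteq> {1..r + s} \<Longrightarrow>
    \<exists>(c :: 'f::field) v. sorted_wrt (<) v \<and> set v \<subseteq> {1..r + s} \<and>
      (\<lambda>w. single 1 u w - single c v w) \<in> clifford_ideal r s"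
proof (induction u)
  case Nil
  have "(\<lambda>w. single 1 [] w - single 1 [] w :: 'f) \<in> clifford_ideal r s"
    by (simp add: clifford_ideal_zero)
  then show ?case by (intro exI[of _ 1] exI[of _ "[]"]) simp
next
  case (Cons i u)
  then obtain c :: 'f and v where v: "sorted_wrt (<) v" "set v \<subseteq> {1..r + s}"
    and cv: "(\<lambda>w. single 1 u w - single c v w) \<in> clifford_ideal r s" by auto
  have i: "i \<in> {1..r + s}" using Cons.prems by simp
  obtain d :: 'f and x where x: "sorted_wrt (<) x" "set x \<subseteq> insert i (set v)"
    and dx: "(\<lambda>w. single 1 (i # v) w - single d x w) \<in> clifford_ideal r s"
    using insert_sorted_word[OF i v] by blast
  have "conv (single 1 [i]) (\<lambda>w. single 1 u w + (- 1) * single c v w) \<in> clifford_ideal r s"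
    using i cv by (intro clifford_ideal_conv_left tensors_single) auto
  moreover have "(\<lambda>w. c * (single 1 (i # v) w - single d x w)) \<in> clifford_ideal r s"
    by (rule clifford_ideal_scale[OF dx])
  ultimately have "(\<lambda>w. conv (single 1 [i]) (\<lambda>w. single 1 u w + (- 1) * single c v w) w +
      c * (single 1 (i # v) w - single d x w)) \<in> clifford_ideal r s"
    by (rule clifford_ideal_add)
  also have "(\<lambda>w. conv (single 1 [i]) (\<lambda>w. single 1 u w + (- 1) * single c v w) w +
      c * (single 1 (i # v) w - single d x w)) = (\<lambda>w. single 1 (i # u) w - single (c * d) x w)"
    unfolding conv_add_right conv_scale_right conv_single_single
    by (simp add: fun_eq_iff) (simp add: single_def algebra_simps)
  finally show ?case
    using x v i by (intro exI[of _ "c * d"] exI[of _ x]) auto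
qed

lemma sort_single:
  fixes c :: "'f::field"
  assumes "set u \<subseteq> {1..r + s}"
  obtains d :: 'f and v where "sorted_wrt (<) v" "set v \<subseteq> {1..r + s}"
    "(\<lambda>w. single c u w - single d v w) \<in> clifford_ideal r s"
proof -
  obtain d :: 'f and v where v: "sorted_wrt (<) v" "set v \<subseteq> {1..r + s}"
    "(\<lambda>w. single 1 u w - single d v w) \<in> clifford_ideal r s"
    using sort_word[OF assms] by blast
  have "(\<lambda>w. c * (single 1 u w - single d v w)) = (\<lambda>w. single c u w - single (c * d) v w)"
    by (simp add: single_def fun_eq_iff algebra_simps)
  then show thesis
    using that[of v "c * d"] v clifford_ideal_scale[OF v(3), of c] by simp
qed

text \<open>A finite set is the letter set of exactly one increasing word, so this is the
  combination of increasing words with the coordinates of p as coefficients.\<close>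

definition normal_form :: "nat \<Rightarrow> nat \<Rightarrow> (nat list \<Rightarrow> 'f::field) \<Rightarrow> nat list \<Rightarrow> 'f" where
  "normal_form r s p = (\<lambda>w. if sorted_wrt (<) w \<and> set w \<subseteq> {1..r + s} then coord r p (set w) else 0)"

lemma normal_form_single_sorted:
  assumes "sorted_wrt (<) u" "set u \<subseteq> {1..r + s}"
  shows "normal_form r s (single c u) = single c u"
proof
  fix w
  have "set w = set u \<longleftrightarrow> w = u" if "sorted_wrt (<) w"
    using strict_sorted_equal[OF that assms(1)] by auto
  then show "normal_form r s (single c u) w = single c u w"
    using assms by (simp add: normal_form_def coord_single_sorted[OF assms(1)] ind_def) (auto simp: single_def)
qed

lemma coord_zero [simp]: "coord r (\<lambda>w. 0) = (\<lambda>A. 0)"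
  by (simp add: coord_def)

text \<open>Each word is congruent to a multiple of an increasing one with the same coordinates, and
  the normal form depends on the coordinates alone, additively.\<close>

lemma normal_form_cong:
  fixes p :: "nat list \<Rightarrow> 'f::field"
  assumes "p \<in> tensors (r + s)"
  shows "(\<lambda>w. p w - normal_form r s p w) \<in> clifford_ideal r s"
  using assms
proof (induction rule: tensors_induct)
  case zero
  show ?case by (simp add: normal_form_def clifford_ideal_zero cong: if_cong)
next
  case (add p c u)
  obtain d :: 'f and v where v: "sorted_wrt (<) v" "set v \<subseteq> {1..r + s}"
    and dv: "(\<lambda>w. single c u w - single d v w) \<in> clifford_ideal r s"
    by (rule sort_single[OF \<open>set u \<subseteq> {1..r + s}\<close>])
  have "coord r (single c u) = coord r (single d v)"
    using \<open>set u \<subseteq> {1..r + s}\<close> v by (intro coord_cong[OF dv] tensors_single)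
  then have "normal_form r s (single c u) = single d v"
    using normal_form_single_sorted[OF v, of d] by (simp add: normal_form_def cong: if_cong)
  moreover have "normal_form r s (\<lambda>w. p w + single c u w) =
      (\<lambda>w. normal_form r s p w + normal_form r s (single c u) w)"
    using add by (simp add: normal_form_def coord_add tensors_single fun_eq_iff)
  ultimately show ?case
    using clifford_ideal_add[OF add.IH dv] by (simp add: algebra_simps)
qed

text \<open>Zero coordinates make the normal form zero, and p is congruent to its normal
  form.\<close>

lemma mem_clifford_ideal_iff:
  "p \<in> clifford_ideal r s \<longleftrightarrow> p \<in> tensors (r + s) \<and> coord r p = (\<lambda>A. 0)"
proof
  assume "p \<in> tensors (r + s) \<and> coord r p = (\<lambda>A. 0)"
  then show "p \<in> clifford_ideal r s" using normal_form_cong[of p r s] by (simp add: normal_form_def cong: if_cong)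
qed (simp add: clifford_ideal_tensors coord_clifford_ideal)

text \<open>The module consists of functions on all sets of naturals, so this has to be proved; it
  puts the eigenvectors into a span indexed by subsets of {1..n}.\<close>

lemma coord_support:
  fixes p :: "nat list \<Rightarrow> 'f::field"
  assumes "p \<in> tensors (r + s)" "coord r p A \<noteq> 0"
  shows "A \<subseteq> {1..r + s}"
proof -
  have "\<forall>A. coord r p A \<noteq> 0 \<longrightarrow> A \<subseteq> {1..r + s}"
    using assms(1)
  proof (induction rule: tensors_induct)
    case zero
    show ?case by simp
  next
    case (add p c u)
    obtain d :: 'f and v where v: "sorted_wrt (<) v" "set v \<subseteq> {1..r + s}"
      and dv: "(\<lambda>w. single c u w - single d v w) \<in> clifford_ideal r s"
      by (rule sort_single[OF \<open>set u \<subseteq> {1..r + s}\<close>])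
    have "coord r (single c u) = coord r (single d v)"
      using \<open>set u \<subseteq> {1..r + s}\<close> v by (intro coord_cong[OF dv] tensors_single)
    then have "coord r (\<lambda>w. p w + single c u w) = (\<lambda>A. coord r p A + d * ind (set v) A)"
      using add by (simp add: coord_add tensors_single coord_single_sorted[OF v(1)])
    then show ?case using add v(2) by (auto simp: ind_def)
  qed
  with assms(2) show ?thesis by blast
qed

section \<open>The quotient and maps induced on it\<close>

definition cl_class :: "nat \<Rightarrow> nat \<Rightarrow> (nat list \<Rightarrow> 'f::field) \<Rightarrow> (nat list \<Rightarrow> 'f) set" where
  "cl_class r s p = clifford_ideal r s +>\<^bsub>tensor_algebra (r + s)\<^esub> p"

lemma mem_cl_class: "q \<in> cl_class r s p \<longleftrightarrow> (\<lambda>w. q w - p w) \<in> clifford_ideal r s"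
proof
  assume "q \<in> cl_class r s p"
  then show "(\<lambda>w. q w - p w) \<in> clifford_ideal r s" by (auto simp: cl_class_def a_r_coset_def')
next
  assume "(\<lambda>w. q w - p w) \<in> clifford_ideal r s"
  then show "q \<in> cl_class r s p"
    unfolding cl_class_def a_r_coset_def' by (auto intro!: bexI[of _ "\<lambda>w. q w - p w"])
qed

lemma cl_class_eq_iff: "cl_class r s p = cl_class r s q \<longleftrightarrow> (\<lambda>w. p w - q w) \<in> clifford_ideal r s"
proof
  assume "cl_class r s p = cl_class r s q"
  moreover have "p \<in> cl_class r s p" by (simp add: mem_cl_class clifford_ideal_zero)
  ultimately show "(\<lambda>w. p w - q w) \<in> clifford_ideal r s" by (simp add: mem_cl_class)
next
  assume pq: "(\<lambda>w. p w - q w) \<in> clifford_ideal r s"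
  have "(\<lambda>w. t w - p w) \<in> clifford_ideal r s \<longleftrightarrow> (\<lambda>w. t w - q w) \<in> clifford_ideal r s" for t
    using clifford_ideal_add[OF _ pq, of "\<lambda>w. t w - p w"]
      clifford_ideal_diff[OF _ pq, of "\<lambda>w. t w - q w"] by auto
  then show "cl_class r s p = cl_class r s q" by (auto simp: mem_cl_class)
qed

lemma cl_class_eq_iff_coord:
  assumes "p \<in> tensors (r + s)" "q \<in> tensors (r + s)"
  shows "cl_class r s p = cl_class r s q \<longleftrightarrow> coord r p = coord r q"
  using assms by (simp add: cl_class_eq_iff mem_clifford_ideal_iff tensors_diff coord_diff fun_eq_iff)

lemma carrier_clifford: "carrier (clifford r s) = cl_class r s ` tensors (r + s)"
  by (auto simp: clifford_def FactRing_def A_RCOSETS_def' cl_class_def)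

lemma ring_clifford: "ring (clifford r s)"
  unfolding clifford_def by (rule ideal.quotient_is_ring[OF ideal_clifford_ideal])

lemma cl_class_hom: "cl_class r s \<in> ring_hom (tensor_algebra (r + s)) (clifford r s)"
  using ideal.rcos_ring_hom[OF ideal_clifford_ideal] unfolding clifford_def cl_class_def[abs_def] .

lemma cl_class_closed [simp]: "p \<in> tensors (r + s) \<Longrightarrow> cl_class r s p \<in> carrier (clifford r s)"
  by (simp add: carrier_clifford)

lemma cl_class_add: "p \<in> tensors (r + s) \<Longrightarrow> q \<in> tensors (r + s) \<Longrightarrow>
    cl_class r s p \<oplus>\<^bsub>clifford r s\<^esub> cl_class r s q = cl_class r s (\<lambda>w. p w + q w)"
  using ring_hom_add[OF cl_class_hom, of p r s q] by simp

lemma cl_class_mult: "p \<in> tensors (r + s) \<Longrightarrow> q \<in> tensors (r + s) \<Longrightarrow>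
    cl_class r s p \<otimes>\<^bsub>clifford r s\<^esub> cl_class r s q = cl_class r s (conv p q)"
  using ring_hom_mult[OF cl_class_hom, of p r s q] by simp

lemma cl_class_one: "\<one>\<^bsub>clifford r s\<^esub> = cl_class r s (single 1 [])"
  by (rule ring_hom_one[OF cl_class_hom, simplified, symmetric])

lemma cl_class_zero: "\<zero>\<^bsub>clifford r s\<^esub> = cl_class r s (\<lambda>w. 0)"
  by (rule ring_hom_zero[OF cl_class_hom ring_tensor_algebra ring_clifford, simplified, symmetric])

lemma cl_class_uminus:
  assumes "p \<in> tensors (r + s)"
  shows "\<ominus>\<^bsub>clifford r s\<^esub> cl_class r s p = cl_class r s (\<lambda>w. - p w)"
proof -
  interpret ring "clifford r s" by (rule ring_clifford)
  have "(\<lambda>w. - p w) \<in> tensors (r + s)" using tensors_scale[OF assms, of "- 1"] by simp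
  then show ?thesis
    using assms minus_equality[of "cl_class r s (\<lambda>w. - p w)" "cl_class r s p"] by (simp add: cl_class_add cl_class_zero)
qed

lemma cl_scalar_eq: "cl_scalar r s a = cl_class r s (single a [])"
  by (simp add: cl_scalar_def cl_class_def tensor_scalar_eq)

lemma cl_vec_eq: "cl_vec r s v = cl_class r s (tensor_vec v)"
  by (simp add: cl_vec_def cl_class_def)

lemma cl_scalar_mult:
  "p \<in> tensors (r + s) \<Longrightarrow> cl_scalar r s a \<otimes>\<^bsub>clifford r s\<^esub> cl_class r s p = cl_class r s (\<lambda>w. a * p w)"
  by (simp add: cl_scalar_eq cl_class_mult tensors_single conv_single_left)

text \<open>The hypothesis \<open>step\<close> is phrased so that it fits homomorphisms and
  anti-homomorphisms alike: in both cases the value at e_i x is determined by the values at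
  \<open>e_i\<close> and x. Words grow from 1 in this way, and linearity does the rest.\<close>

lemma cl_map_unique:
  fixes f g :: "(nat list \<Rightarrow> 'f::field) set \<Rightarrow> (nat list \<Rightarrow> 'f) set"
  assumes ext: "f \<in> extensional (carrier (clifford r s))" "g \<in> extensional (carrier (clifford r s))"
    and hom: "cl_homogeneous r s f" "cl_homogeneous r s g"
    and add_fg: "\<And>h x y. h \<in> {f, g} \<Longrightarrow> x \<in> carrier (clifford r s) \<Longrightarrow> y \<in> carrier (clifford r s) \<Longrightarrow>
        h (x \<oplus>\<^bsub>clifford r s\<^esub> y) = h x \<oplus>\<^bsub>clifford r s\<^esub> h y"
    and one: "f \<one>\<^bsub>clifford r s\<^esub> = g \<one>\<^bsub>clifford r s\<^esub>"
    and step: "\<And>i x. i \<in> {1..r + s} \<Longrightarrow> x \<in> carrier (clifford r s) \<Longrightarrow> f x = g x \<Longrightarrow>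
        f (cl_vec r s (basis_vec i) \<otimes>\<^bsub>clifford r s\<^esub> x) =
        g (cl_vec r s (basis_vec i) \<otimes>\<^bsub>clifford r s\<^esub> x)"
  shows "f = g"
proof (rule extensionalityI[OF ext])
  have word: "set u \<subseteq> {1..r + s} \<Longrightarrow> f (cl_class r s (single 1 u)) = g (cl_class r s (single 1 u))" for u
  proof (induction u)
    case Nil
    show ?case using one by (simp add: cl_class_one)
  next
    case (Cons i u)
    have "cl_class r s (single 1 (i # u) :: nat list \<Rightarrow> 'f) =
        cl_vec r s (basis_vec i) \<otimes>\<^bsub>clifford r s\<^esub> cl_class r s (single 1 u)"
      using Cons.prems
      by (simp add: cl_vec_eq tensor_vec_basis cl_class_mult tensors_single conv_single_single)
    then show ?case using Cons step[of i "cl_class r s (single 1 u)"] by (simp add: tensors_single)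
  qed
  have scale: "h (cl_class r s (\<lambda>w. a * p w)) = cl_scalar r s a \<otimes>\<^bsub>clifford r s\<^esub> h (cl_class r s p)"
    if "h \<in> {f, g}" "p \<in> tensors (r + s)" for h a p
  proof -
    have "cl_homogeneous r s h" using that hom by blast
    then show ?thesis using that(2) by (simp add: cl_homogeneous_def flip: cl_scalar_mult)
  qed
  have "f (cl_class r s p) = g (cl_class r s p)" if "p \<in> tensors (r + s)" for p
    using that
  proof (induction rule: tensors_induct)
    case zero
    \<comment> \<open>Values of f and g are not known to lie in the carrier, so f 0 = f 0 + f 0
      cannot be cancelled; zero is treated as 0 times 1 instead.\<close>
    have "(single 1 [] :: nat list \<Rightarrow> 'f) \<in> tensors (r + s)" by (simp add: tensors_single)
    then show ?case
      using scale[of f "single 1 []" 0] scale[of g "single 1 []" 0] word[of "[]"] by simp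
  next
    case (add p c u)
    have "single c u = (\<lambda>w. c * single 1 u w)" by (simp add: single_def fun_eq_iff)
    then have "f (cl_class r s (single c u)) = g (cl_class r s (single c u))"
      using scale[of f "single 1 u" c] scale[of g "single 1 u" c] word[of u] add
      by (simp add: tensors_single)
    then show ?case
      using add_fg[of f "cl_class r s p" "cl_class r s (single c u)"]
        add_fg[of g "cl_class r s p" "cl_class r s (single c u)"] add by (simp add: cl_class_add tensors_single)
  qed
  then show "\<And>x. x \<in> carrier (clifford r s) \<Longrightarrow> f x = g x" by (auto simp: carrier_clifford)
qed

text \<open>
  A common frame for \<open>c\<close> (with \<open>\<pi>\<close> the reversal) and \<open>\<beta>\<close> (with \<open>\<pi>\<close> the identity).
\<close>

definition twist ::
    "(nat list \<Rightarrow> 'f::field) \<Rightarrow> (nat list \<Rightarrow> nat list) \<Rightarrow> (nat list \<Rightarrow> 'f) \<Rightarrow> nat list \<Rightarrow> 'f" where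
  "twist \<gamma> \<pi> p = (\<lambda>w. \<gamma> w * p (\<pi> w))"

text \<open>The conditions on \<gamma> and \<pi> make the twist an involution, hence bijective; the
  disjunction in \<open>twist_conv\<close> admits automorphisms and anti-automorphisms.\<close>

locale word_twist =
  fixes r s :: nat and \<gamma> :: "nat list \<Rightarrow> 'f::field" and \<pi> :: "nat list \<Rightarrow> nat list"
  assumes \<pi>_\<pi>: "\<pi> (\<pi> w) = w"
    and set_\<pi>: "set (\<pi> w) = set w"
    and \<gamma>_\<pi>: "\<gamma> (\<pi> w) = \<gamma> w"
    and \<gamma>_\<gamma>: "\<gamma> w * \<gamma> w = 1"
    and twist_rels: "p \<in> cl_rels r s \<Longrightarrow> twist \<gamma> \<pi> p \<in> clifford_ideal r s"
    and twist_conv: "(\<forall>p q. twist \<gamma> \<pi> (conv p q) = conv (twist \<gamma> \<pi> p) (twist \<gamma> \<pi> q)) \<or>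
      (\<forall>p q. twist \<gamma> \<pi> (conv p q) = conv (twist \<gamma> \<pi> q) (twist \<gamma> \<pi> p))"
begin

abbreviation \<tau> where "\<tau> \<equiv> twist \<gamma> \<pi>"

lemma \<tau>_\<tau> [simp]: "\<tau> (\<tau> p) = p"
proof
  fix w
  have "\<tau> (\<tau> p) w = (\<gamma> w * \<gamma> w) * p w"
    unfolding twist_def by (simp only: \<gamma>_\<pi> \<pi>_\<pi> mult.assoc)
  then show "\<tau> (\<tau> p) w = p w" by (simp add: \<gamma>_\<gamma>)
qed

lemma \<tau>_add: "\<tau> (\<lambda>w. p w + q w) = (\<lambda>w. \<tau> p w + \<tau> q w)"
  by (simp add: twist_def algebra_simps)

lemma \<tau>_diff: "\<tau> (\<lambda>w. p w - q w) = (\<lambda>w. \<tau> p w - \<tau> q w)"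
  by (simp add: twist_def algebra_simps)

lemma \<tau>_scale: "\<tau> (\<lambda>w. a * p w) = (\<lambda>w. a * \<tau> p w)"
  by (simp add: twist_def algebra_simps)

lemma \<tau>_zero [simp]: "\<tau> (\<lambda>w. 0) = (\<lambda>w. 0)"
  by (simp add: twist_def)

lemma \<tau>_single: "\<tau> (single c u) = single (\<gamma> u * c) (\<pi> u)"
proof -
  have "\<pi> w = u \<longleftrightarrow> w = \<pi> u" for w using \<pi>_\<pi> by metis
  then show ?thesis by (auto simp: twist_def single_def fun_eq_iff \<pi>_\<pi> \<gamma>_\<pi>)
qed

lemma \<tau>_tensors [simp]: "p \<in> tensors n \<Longrightarrow> \<tau> p \<in> tensors n"
proof (induction rule: tensors_induct)
  case (add p c u)
  then show ?case by (simp add: \<tau>_add \<tau>_single tensors_add tensors_single set_\<pi>)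
qed simp

text \<open>The preimage of the ideal is two-sided whether products are preserved or reversed, so it
  is enough to check the relations.\<close>

lemma \<tau>_clifford_ideal: "p \<in> clifford_ideal r s \<Longrightarrow> \<tau> p \<in> clifford_ideal r s"
proof -
  let ?J = "{p. \<tau> p \<in> clifford_ideal r s}"
  have "ideal ?J (tensor_algebra (r + s))"
  proof (rule tensor_idealI)
    show "?J \<subseteq> tensors (r + s)"
    proof
      fix p assume "p \<in> ?J"
      then have "\<tau> (\<tau> p) \<in> tensors (r + s)"
        by (intro \<tau>_tensors clifford_ideal_tensors) simp
      then show "p \<in> tensors (r + s)" by simp
    qed
    show "conv q p \<in> ?J" "conv p q \<in> ?J" if "p \<in> ?J" "q \<in> tensors (r + s)" for p q
      using twist_conv that by (auto simp: clifford_ideal_conv_left clifford_ideal_conv_right)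
  qed (simp_all add: clifford_ideal_zero \<tau>_add clifford_ideal_add)
  moreover have "cl_rels r s \<subseteq> ?J" using twist_rels by blast
  ultimately have "clifford_ideal r s \<subseteq> ?J" by (rule clifford_ideal_least)
  then show "p \<in> clifford_ideal r s \<Longrightarrow> \<tau> p \<in> clifford_ideal r s" by blast
qed

text \<open>Taking the image of a coset avoids a choice of representatives; the restriction supplies
  the extensionality that the definite descriptions ask for.\<close>

definition cl_map :: "(nat list \<Rightarrow> 'f) set \<Rightarrow> (nat list \<Rightarrow> 'f) set" where
  "cl_map = restrict ((`) \<tau>) (carrier (clifford r s))"

lemma cl_map_cl_class:
  assumes "p \<in> tensors (r + s)"
  shows "cl_map (cl_class r s p) = cl_class r s (\<tau> p)"
proof -
  have "q \<in> \<tau> ` cl_class r s p \<longleftrightarrow> q \<in> cl_class r s (\<tau> p)" for q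
  proof -
    have "q \<in> \<tau> ` cl_class r s p \<longleftrightarrow> \<tau> q \<in> cl_class r s p" by (auto simp: image_iff intro: bexI[of _ "\<tau> q"])
    also have "\<dots> \<longleftrightarrow> \<tau> (\<lambda>w. q w - \<tau> p w) \<in> clifford_ideal r s" by (simp add: mem_cl_class \<tau>_diff)
    also have "\<dots> \<longleftrightarrow> q \<in> cl_class r s (\<tau> p)" unfolding mem_cl_class
      using \<tau>_clifford_ideal[of "\<tau> (\<lambda>w. q w - \<tau> p w)"] \<tau>_clifford_ideal by auto
    finally show ?thesis .
  qed
  then show ?thesis using assms by (auto simp: cl_map_def)
qed

lemma cl_map_cl_map: "x \<in> carrier (clifford r s) \<Longrightarrow> cl_map (cl_map x) = x"
  by (auto simp: carrier_clifford cl_map_cl_class)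

lemma cl_map_closed: "x \<in> carrier (clifford r s) \<Longrightarrow> cl_map x \<in> carrier (clifford r s)"
  by (auto simp: carrier_clifford cl_map_cl_class)

lemma bij_cl_map: "bij_betw cl_map (carrier (clifford r s)) (carrier (clifford r s))"
  by (rule bij_betw_byWitness[of _ cl_map]) (auto simp: cl_map_cl_map cl_map_closed)

lemma cl_map_add:
  "x \<in> carrier (clifford r s) \<Longrightarrow> y \<in> carrier (clifford r s) \<Longrightarrow>
    cl_map (x \<oplus>\<^bsub>clifford r s\<^esub> y) = cl_map x \<oplus>\<^bsub>clifford r s\<^esub> cl_map y"
  by (auto simp: carrier_clifford cl_map_cl_class cl_class_add tensors_add \<tau>_add)

lemma cl_homogeneous_cl_map: "cl_homogeneous r s cl_map"
  by (auto simp: cl_homogeneous_def carrier_clifford cl_map_cl_class cl_scalar_mult tensors_scale \<tau>_scale)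

lemma cl_map_extensional: "cl_map \<in> extensional (carrier (clifford r s))"
  by (simp add: cl_map_def)

text \<open>Since the twist preserves the ideal, any word may be sorted before twisting, so a
  diagonal action on increasing words is diagonal everywhere.\<close>

lemma coord_twist:
  assumes eigen: "\<And>u. sorted_wrt (<) u \<Longrightarrow> set u \<subseteq> {1..r + s} \<Longrightarrow>
      coord r (\<tau> (single 1 u)) = (\<lambda>A. l (set u) * ind (set u) A)"
    and "p \<in> tensors (r + s)"
  shows "coord r (\<tau> p) A = l A * coord r p A"
  using assms(2)
proof (induction rule: tensors_induct)
  case zero
  show ?case by simp
next
  case (add p c u)
  note u = \<open>set u \<subseteq> {1..r + s}\<close>
  obtain d :: 'f and v where v: "sorted_wrt (<) v" "set v \<subseteq> {1..r + s}"
    and dv: "(\<lambda>w. single c u w - single d v w) \<in> clifford_ideal r s"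
    by (rule sort_single[OF u])
  have tens: "single c u \<in> tensors (r + s)" "single d v \<in> tensors (r + s)" "single 1 v \<in> tensors (r + s)"
    for c d :: 'f
    using u v by (simp_all add: tensors_single)
  have "coord r (single c u) A = coord r (single d v) A"
    by (simp add: coord_cong[OF dv tens(1,2)])
  moreover have "coord r (\<tau> (single c u)) = coord r (\<tau> (single d v))"
    using \<tau>_clifford_ideal[OF dv] tens by (intro coord_cong[of _ _ r s]) (simp_all add: \<tau>_diff)
  moreover have "coord r (\<tau> (single d v)) A = l A * coord r (single d v) A"
  proof -
    have "single d v = (\<lambda>w. d * single 1 v w)" by (simp add: single_def fun_eq_iff)
    then have "coord r (\<tau> (single d v)) = coord r (\<lambda>w. d * \<tau> (single 1 v) w)"
      by (simp only: \<tau>_scale)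
    also have "\<dots> = (\<lambda>A. d * (l (set v) * ind (set v) A))"
      by (simp only: coord_scale[OF \<tau>_tensors[OF tens(3)]] eigen[OF v])
    finally show ?thesis by (simp add: coord_single_sorted[OF v(1)]) (simp add: ind_def)
  qed
  ultimately show ?case
    using add tens by (simp add: \<tau>_add coord_add[of _ "r + s"] algebra_simps)
qed

end

section \<open>The conjugation and the automorphism beta\<close>

lemma tensor_vec_Cons [simp]: "tensor_vec v [i] = v i"
  by (simp add: tensor_vec_def)

lemma tensor_vec_eq_0 [simp]: "length w \<noteq> 1 \<Longrightarrow> tensor_vec v w = 0"
  by (cases w rule: remdups_adj.cases) (auto simp: tensor_vec_def)

text \<open>Cutting the reversed word after n - k letters gives the reversed pieces of the cut of w
  after k letters, in swapped order; the substitution of n - k for k therefore exchanges the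
  factors.\<close>

lemma twist_conv_rev:
  "twist (\<lambda>w. (- 1) ^ length w) rev (conv p q) =
    conv (twist (\<lambda>w. (- 1) ^ length w) rev q) (twist (\<lambda>w. (- 1) ^ length w) rev p)"
proof
  fix w :: "nat list"
  let ?n = "length w"
  let ?g = "\<lambda>k. p (take k (rev w)) * q (drop k (rev w))"
  have "conv p q (rev w) = (\<Sum>k\<le>?n. ?g (?n - k))"
    unfolding conv_def length_rev by (rule sum.reindex_bij_witness[of _ "(-) ?n" "(-) ?n"]) auto
  also have "(- 1) ^ ?n * \<dots> =
      (\<Sum>k\<le>?n. (- 1) ^ k * q (rev (take k w)) * ((- 1) ^ (?n - k) * p (rev (drop k w))))"
    unfolding sum_distrib_left
  proof (rule sum.cong[OF refl])
    fix k assume "k \<in> {..?n}"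
    then have k: "k \<le> ?n" by simp
    have "(- 1 :: 'a) ^ ?n = (- 1) ^ k * (- 1) ^ (?n - k)" using k by (simp flip: power_add)
    then show "(- 1) ^ ?n * ?g (?n - k) =
        (- 1) ^ k * q (rev (take k w)) * ((- 1) ^ (?n - k) * p (rev (drop k w)))"
      using k by (simp add: take_rev drop_rev)
  qed
  finally show "twist (\<lambda>w. (- 1) ^ length w) rev (conv p q) w =
    conv (twist (\<lambda>w. (- 1) ^ length w) rev q) (twist (\<lambda>w. (- 1) ^ length w) rev p) w"
    by (simp add: twist_def) (simp add: conv_def)
qed

lemma twist_conv_id:
  assumes "\<And>u v. \<gamma> (u @ v) = \<gamma> u * \<gamma> v"
  shows "twist \<gamma> (\<lambda>w. w) (conv p q) = conv (twist \<gamma> (\<lambda>w. w) p) (twist \<gamma> (\<lambda>w. w) q)"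
proof
  fix w
  have "\<gamma> w * (p (take k w) * q (drop k w)) =
      \<gamma> (take k w) * p (take k w) * (\<gamma> (drop k w) * q (drop k w))" for k
    using assms[of "take k w" "drop k w"] by (simp only: append_take_drop_id mult_ac)
  then show "twist \<gamma> (\<lambda>w. w) (conv p q) w = conv (twist \<gamma> (\<lambda>w. w) p) (twist \<gamma> (\<lambda>w. w) q) w"
    unfolding twist_def conv_def sum_distrib_left by (intro sum.cong refl)
qed

lemma twist_rev_tensor_vec:
  "twist (\<lambda>w. (- 1) ^ length w) rev (tensor_vec v) = (\<lambda>w. - tensor_vec v w)"
proof
  fix w :: "nat list"
  show "twist (\<lambda>w. (- 1) ^ length w) rev (tensor_vec v) w = - tensor_vec v w"
    by (cases "length w = 1") (auto simp: twist_def length_Suc_conv)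
qed

definition neg_sign :: "nat \<Rightarrow> nat list \<Rightarrow> 'f::field" where
  "neg_sign r w = (- 1) ^ length (filter ((<) r) w)"

lemma neg_sign_append: "neg_sign r (u @ v) = neg_sign r u * neg_sign r v"
  by (simp add: neg_sign_def power_add)

lemma twist_neg_sign_tensor_vec:
  "twist (neg_sign r) (\<lambda>w. w) (tensor_vec v) = tensor_vec (\<lambda>i. neg_sign r [i] * v i)"
proof
  fix w :: "nat list"
  show "twist (neg_sign r) (\<lambda>w. w) (tensor_vec v) w = tensor_vec (\<lambda>i. neg_sign r [i] * v i) w"
    by (cases "length w = 1") (auto simp: twist_def length_Suc_conv)
qed

text \<open>Every relation is fixed: v v is its own reversal, and its two signs cancel.\<close>

interpretation conj: word_twist r s "\<lambda>w. (- 1) ^ length w :: 'f::field" rev for r s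
proof
  fix p :: "nat list \<Rightarrow> 'f"
  assume "p \<in> cl_rels r s"
  then obtain v where v: "v \<in> Fvec (r + s)"
    "p = (\<lambda>w. conv (tensor_vec v) (tensor_vec v) w + single (Qform r s v v) [] w)"
    by (auto simp: cl_rels_def)
  have "twist (\<lambda>w. (- 1) ^ length w) rev (conv (tensor_vec v) (tensor_vec v)) =
      conv (\<lambda>w. (- 1) * tensor_vec v w) (\<lambda>w. (- 1) * tensor_vec v w)"
    by (simp add: twist_conv_rev twist_rev_tensor_vec)
  also have "\<dots> = conv (tensor_vec v) (tensor_vec v)"
    unfolding conv_scale_left conv_scale_right by simp
  finally have "twist (\<lambda>w. (- 1) ^ length w) rev p = p"
    unfolding v(2) by (auto simp: twist_def fun_eq_iff algebra_simps) (auto simp: single_def)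
  moreover have "p \<in> clifford_ideal r s" unfolding v(2) by (rule clifford_rel[OF v(1)])
  ultimately show "twist (\<lambda>w. (- 1) ^ length w) rev p \<in> clifford_ideal r s" by simp
qed (auto simp: twist_conv_rev simp flip: power_mult_distrib)

text \<open>The relation of v goes to that of the vector with the coordinates beyond r negated, on
  which Q takes the same value.\<close>

interpretation beta: word_twist r s "neg_sign r :: _ \<Rightarrow> 'f::field" "\<lambda>w. w" for r s
proof
  fix p :: "nat list \<Rightarrow> 'f"
  assume "p \<in> cl_rels r s"
  then obtain v where v: "v \<in> Fvec (r + s)"
    "p = (\<lambda>w. conv (tensor_vec v) (tensor_vec v) w + single (Qform r s v v) [] w)"
    by (auto simp: cl_rels_def)
  let ?v = "\<lambda>i. neg_sign r [i] * v i"
  have "twist (neg_sign r) (\<lambda>w. w) (conv (tensor_vec v) (tensor_vec v)) =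
      conv (tensor_vec ?v) (tensor_vec ?v)"
    by (simp add: twist_conv_id neg_sign_append twist_neg_sign_tensor_vec)
  moreover have "twist (neg_sign r) (\<lambda>w. w) (single (Qform r s v v) []) = single (Qform r s v v) []"
    by (auto simp: twist_def single_def neg_sign_def)
  moreover have "Qform r s ?v ?v = Qform r s v v"
    unfolding Qform_gen_sq by (intro sum.cong refl) (simp add: neg_sign_def)
  ultimately have "twist (neg_sign r) (\<lambda>w. w) p =
      (\<lambda>w. conv (tensor_vec ?v) (tensor_vec ?v) w + single (Qform r s ?v ?v) [] w)"
    unfolding v(2) by (simp add: twist_def fun_eq_iff algebra_simps)
  moreover have "?v \<in> Fvec (r + s)" using v(1) by (simp add: Fvec_def)
  ultimately show "twist (neg_sign r) (\<lambda>w. w) p \<in> clifford_ideal r s"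
    using clifford_rel[of ?v r s] by simp
qed (auto simp: twist_conv_id neg_sign_append, simp add: neg_sign_def flip: power_mult_distrib)

lemma cl_anti_automorphismD:
  assumes "cl_anti_automorphism r s f"
  shows "cl_homogeneous r s f" "f \<one>\<^bsub>clifford r s\<^esub> = \<one>\<^bsub>clifford r s\<^esub>"
    and "\<And>x y. x \<in> carrier (clifford r s) \<Longrightarrow> y \<in> carrier (clifford r s) \<Longrightarrow>
      f (x \<oplus>\<^bsub>clifford r s\<^esub> y) = f x \<oplus>\<^bsub>clifford r s\<^esub> f y"
    and "\<And>x y. x \<in> carrier (clifford r s) \<Longrightarrow> y \<in> carrier (clifford r s) \<Longrightarrow>
      f (x \<otimes>\<^bsub>clifford r s\<^esub> y) = f y \<otimes>\<^bsub>clifford r s\<^esub> f x"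
  using assms by (auto simp: cl_anti_automorphism_def ring_iso_def ring_hom_def)

lemma cl_automorphismD:
  assumes "cl_automorphism r s f"
  shows "cl_homogeneous r s f" "f \<one>\<^bsub>clifford r s\<^esub> = \<one>\<^bsub>clifford r s\<^esub>"
    and "\<And>x y. x \<in> carrier (clifford r s) \<Longrightarrow> y \<in> carrier (clifford r s) \<Longrightarrow>
      f (x \<oplus>\<^bsub>clifford r s\<^esub> y) = f x \<oplus>\<^bsub>clifford r s\<^esub> f y"
    and "\<And>x y. x \<in> carrier (clifford r s) \<Longrightarrow> y \<in> carrier (clifford r s) \<Longrightarrow>
      f (x \<otimes>\<^bsub>clifford r s\<^esub> y) = f x \<otimes>\<^bsub>clifford r s\<^esub> f y"
  using assms by (auto simp: cl_automorphism_def ring_iso_def ring_hom_def)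

lemma cl_vec_basis_closed:
  "i \<in> {1..r + s} \<Longrightarrow> cl_vec r s (basis_vec i) \<in> carrier (clifford r s)"
  by (simp add: cl_vec_eq tensor_vec_basis tensors_single)

text \<open>The twist gives existence. For uniqueness, any candidate sends e_i x to the image of x
  times - e_i.\<close>

lemma cl_conj_eq:
  fixes r s :: nat
  shows "cl_conj r s = (conj.cl_map r s :: (nat list \<Rightarrow> 'f::field) set \<Rightarrow> _)"
proof -
  let ?c = "conj.cl_map r s :: (nat list \<Rightarrow> 'f) set \<Rightarrow> _"
  have "?c (x \<otimes>\<^bsub>clifford r s\<^esub> y) = ?c y \<otimes>\<^bsub>clifford r s\<^esub> ?c x"
    if "x \<in> carrier (clifford r s)" "y \<in> carrier (clifford r s)" for x y
    using that
    by (auto simp: carrier_clifford conj.cl_map_cl_class cl_class_mult tensors_conv twist_conv_rev)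
  moreover have "?c \<one>\<^bsub>clifford r s\<^esub> = \<one>\<^bsub>clifford r s\<^esub>"
    by (simp add: cl_class_one conj.cl_map_cl_class tensors_single conj.\<tau>_single)
  ultimately have anti: "cl_anti_automorphism r s ?c"
    by (auto simp: cl_anti_automorphism_def ring_iso_def ring_hom_def conj.cl_map_closed
        conj.bij_cl_map conj.cl_map_add conj.cl_homogeneous_cl_map)
  have vec: "?c (cl_vec r s v) = \<ominus>\<^bsub>clifford r s\<^esub> cl_vec r s v" if "v \<in> Fvec (r + s)" for v
    using that
    by (simp add: cl_vec_eq conj.cl_map_cl_class tensor_vec_mem cl_class_uminus twist_rev_tensor_vec)
  show ?thesis
    unfolding cl_conj_def
  proof (rule the_equality, intro conjI ballI)
    fix c :: "(nat list \<Rightarrow> 'f) set \<Rightarrow> (nat list \<Rightarrow> 'f) set"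
    assume c: "c \<in> extensional (carrier (clifford r s)) \<and> cl_anti_automorphism r s c \<and>
      (\<forall>v\<in>Fvec (r + s). c (cl_vec r s v) = \<ominus>\<^bsub>clifford r s\<^esub> cl_vec r s v)"
    note cD = cl_anti_automorphismD[of r s c] and D = cl_anti_automorphismD[OF anti]
    show "c = ?c"
    proof (rule cl_map_unique)
      fix i and x :: "(nat list \<Rightarrow> 'f) set"
      assume "i \<in> {1..r + s}" "x \<in> carrier (clifford r s)" "c x = ?c x"
      then show "c (cl_vec r s (basis_vec i) \<otimes>\<^bsub>clifford r s\<^esub> x) =
          ?c (cl_vec r s (basis_vec i) \<otimes>\<^bsub>clifford r s\<^esub> x)"
        using c by (simp only: cD(4) D(4) cl_vec_basis_closed) (simp add: vec basis_vec_mem)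
    qed (use c D cD conj.cl_map_extensional in auto)
  qed (use anti vec conj.cl_map_extensional in auto)
qed

lemma cl_beta_eq:
  fixes r s :: nat
  shows "cl_beta r s = (beta.cl_map r s :: (nat list \<Rightarrow> 'f::field) set \<Rightarrow> _)"
proof -
  let ?b = "beta.cl_map r s :: (nat list \<Rightarrow> 'f) set \<Rightarrow> _"
  have "?b (x \<otimes>\<^bsub>clifford r s\<^esub> y) = ?b x \<otimes>\<^bsub>clifford r s\<^esub> ?b y"
    if "x \<in> carrier (clifford r s)" "y \<in> carrier (clifford r s)" for x y
    using that
    by (auto simp: carrier_clifford beta.cl_map_cl_class cl_class_mult tensors_conv twist_conv_id neg_sign_append)
  moreover have "?b \<one>\<^bsub>clifford r s\<^esub> = \<one>\<^bsub>clifford r s\<^esub>"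
    by (simp add: cl_class_one beta.cl_map_cl_class tensors_single beta.\<tau>_single) (simp add: neg_sign_def)
  ultimately have aut: "cl_automorphism r s ?b"
    by (auto simp: cl_automorphism_def ring_iso_def ring_hom_def beta.cl_map_closed
        beta.bij_cl_map beta.cl_map_add beta.cl_homogeneous_cl_map)
  have vec: "?b (cl_vec r s (basis_vec i)) =
      (if i \<le> r then cl_vec r s (basis_vec i) else \<ominus>\<^bsub>clifford r s\<^esub> cl_vec r s (basis_vec i))"
    if "i \<in> {1..r + s}" for i
  proof -
    have "(single 1 [i] :: nat list \<Rightarrow> 'f) \<in> tensors (r + s)" using that by (simp add: tensors_single)
    moreover have "single (- 1 :: 'f) [i] = (\<lambda>w. - single 1 [i] w)" by (auto simp: single_def)
    ultimately show ?thesis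
      by (simp add: cl_vec_eq tensor_vec_basis beta.cl_map_cl_class beta.\<tau>_single cl_class_uminus neg_sign_def)
  qed
  show ?thesis
    unfolding cl_beta_def
  proof (rule the_equality, intro conjI ballI)
    fix b :: "(nat list \<Rightarrow> 'f) set \<Rightarrow> (nat list \<Rightarrow> 'f) set"
    assume b: "b \<in> extensional (carrier (clifford r s)) \<and> cl_automorphism r s b \<and>
      (\<forall>i\<in>{1..r}. b (cl_vec r s (basis_vec i)) = cl_vec r s (basis_vec i)) \<and>
      (\<forall>j\<in>{1..s}. b (cl_vec r s (basis_vec (r + j))) = \<ominus>\<^bsub>clifford r s\<^esub> cl_vec r s (basis_vec (r + j)))"
    note bD = cl_automorphismD[of r s b] and D = cl_automorphismD[OF aut]
    have b_vec: "b (cl_vec r s (basis_vec i)) = ?b (cl_vec r s (basis_vec i))"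
      if i: "i \<in> {1..r + s}" for i
    proof (cases "i \<le> r")
      case True
      then show ?thesis using b i by (simp add: vec)
    next
      case False
      \<comment> \<open>The specification of \<open>cl_beta\<close> indexes the negative generators
        as r + j.\<close>
      then have "i - r \<in> {1..s}" "i = r + (i - r)" using i by auto
      then show ?thesis using b vec[OF i] False by metis
    qed
    show "b = ?b"
    proof (rule cl_map_unique)
      fix i and x :: "(nat list \<Rightarrow> 'f) set"
      assume "i \<in> {1..r + s}" "x \<in> carrier (clifford r s)" "b x = ?b x"
      then show "b (cl_vec r s (basis_vec i) \<otimes>\<^bsub>clifford r s\<^esub> x) =
          ?b (cl_vec r s (basis_vec i) \<otimes>\<^bsub>clifford r s\<^esub> x)"
        using b by (simp only: bD(4) D(4) cl_vec_basis_closed b_vec)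
    qed (use b D bD beta.cl_map_extensional in auto)
  qed (use aut vec beta.cl_map_extensional in auto)
qed

section \<open>Dimension and eigenspaces\<close>

text \<open>The span of the \<open>e_A\<close> with A in S, described by supports, which is the form
  in which eigenspaces of diagonal maps appear.\<close>

definition cl_span :: "nat \<Rightarrow> nat \<Rightarrow> nat set set \<Rightarrow> (nat list \<Rightarrow> 'f::field) set set" where
  "cl_span r s S = cl_class r s ` {p \<in> tensors (r + s). \<forall>A. coord r p A \<noteq> 0 \<longrightarrow> A \<in> S}"

lemma cl_class_mem_cl_span:
  assumes "p \<in> tensors (r + s)"
  shows "cl_class r s p \<in> cl_span r s S \<longleftrightarrow> (\<forall>A. coord r p A \<noteq> 0 \<longrightarrow> A \<in> S)"
  using assms by (auto simp: cl_span_def image_iff cl_class_eq_iff_coord)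

lemma cl_span_subset: "cl_span r s S \<subseteq> carrier (clifford r s)"
  by (auto simp: cl_span_def)

lemma set_eqI_cl_class:
  assumes "X \<subseteq> carrier (clifford r s)" "Y \<subseteq> carrier (clifford r s)"
    and "\<And>p. p \<in> tensors (r + s) \<Longrightarrow> cl_class r s p \<in> X \<longleftrightarrow> cl_class r s p \<in> Y"
  shows "X = Y"
  using assms unfolding carrier_clifford by blast

text \<open>The predicate \<open>ring.dimension\<close> grows by line extensions, so one
  \<open>e_A\<close> is adjoined at a time; it lies outside the previous span because its coordinate
  at A is 1.\<close>

lemma dimension_cl_span:
  assumes "finite S" "S \<subseteq> Pow {1..r + s}"
  shows "ring.dimension (clifford r s) (card S) (range (cl_scalar r s))
    (cl_span r s S :: (nat list \<Rightarrow> 'f::field) set set)"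
  using assms
proof (induction S rule: finite_induct)
  interpret C: ring "clifford r s :: (nat list \<Rightarrow> 'f) set ring" by (rule ring_clifford)
  case empty
  have "cl_span r s {} = {\<zero>\<^bsub>clifford r s\<^esub> :: (nat list \<Rightarrow> 'f) set}"
    by (rule set_eqI_cl_class[OF cl_span_subset])
      (auto simp: cl_class_mem_cl_span cl_class_zero cl_class_eq_iff_coord fun_eq_iff)
  then show ?case by simp
next
  interpret C: ring "clifford r s :: (nat list \<Rightarrow> 'f) set ring" by (rule ring_clifford)
  case (insert A S)
  have "finite A" using insert.prems finite_subset[of A "{1..r + s}"] by simp
  then obtain u where u: "sorted_wrt (<) u" "set u = A"
    using sorted_list_of_set.strict_sorted_key_list_of_set[of A] set_sorted_list_of_set by blast
  let ?e = "single 1 u :: nat list \<Rightarrow> 'f"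
  let ?v = "cl_class r s ?e"
  have e: "?e \<in> tensors (r + s)" using insert.prems u by (intro tensors_single) auto
  have coord_e: "coord r ?e = ind A" using coord_single_sorted[OF u(1), of r 1] u(2) by simp
  have "?v \<notin> cl_span r s S"
    using insert.hyps by (simp add: cl_class_mem_cl_span e coord_e) (simp add: ind_def)
  then have dim: "C.dimension (Suc (card S)) (range (cl_scalar r s))
      (C.line_extension (range (cl_scalar r s)) ?v (cl_span r s S))"
    using insert e by (intro C.Suc_dim) auto
  have coord_add_e: "coord r (\<lambda>w. p w + a * ?e w) = (\<lambda>B. coord r p B + a * ind A B)"
    if "p \<in> tensors (r + s)" for p a
    using that e by (simp add: coord_add[of _ "r + s"] tensors_scale coord_scale coord_e)
  have line: "cl_class r s p \<in> C.line_extension (range (cl_scalar r s)) ?v (cl_span r s S) \<longleftrightarrow>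
      cl_class r s p \<in> cl_span r s (insert A S)" if p: "p \<in> tensors (r + s)" for p
  proof
    assume "cl_class r s p \<in> C.line_extension (range (cl_scalar r s)) ?v (cl_span r s S)"
    then obtain a q where q: "q \<in> tensors (r + s)" "cl_class r s q \<in> cl_span r s S"
      and "cl_class r s p = cl_scalar r s a \<otimes>\<^bsub>clifford r s\<^esub> ?v \<oplus>\<^bsub>clifford r s\<^esub> cl_class r s q"
      unfolding C.line_extension_mem_iff by (auto simp: cl_span_def)
    then have "cl_class r s p = cl_class r s (\<lambda>w. q w + a * ?e w)"
      using e by (simp add: cl_scalar_mult cl_class_add tensors_scale add.commute)
    moreover have "(\<lambda>w. q w + a * ?e w) \<in> tensors (r + s)"
      using q e by (simp add: tensors_add tensors_scale)
    ultimately show "cl_class r s p \<in> cl_span r s (insert A S)"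
      using q by (auto simp: cl_class_mem_cl_span coord_add_e ind_def)
  next
    assume A: "cl_class r s p \<in> cl_span r s (insert A S)"
    \<comment> \<open>Subtracting a e_A removes A from the support.\<close>
    define a where "a = coord r p A"
    define q where "q = (\<lambda>w. p w + (- a) * ?e w)"
    have q: "q \<in> tensors (r + s)" using p e by (simp only: q_def tensors_add tensors_scale)
    have "cl_class r s q \<in> cl_span r s S"
      using A p unfolding cl_class_mem_cl_span[OF q] unfolding q_def coord_add_e[OF p]
      by (auto simp: cl_class_mem_cl_span ind_def a_def)
    moreover have "p = (\<lambda>w. a * ?e w + q w)" by (simp add: q_def)
    then have "cl_class r s p = cl_scalar r s a \<otimes>\<^bsub>clifford r s\<^esub> ?v \<oplus>\<^bsub>clifford r s\<^esub> cl_class r s q"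
      using e q by (simp add: cl_scalar_mult cl_class_add tensors_scale)
    ultimately show "cl_class r s p \<in> C.line_extension (range (cl_scalar r s)) ?v (cl_span r s S)"
      unfolding C.line_extension_mem_iff by blast
  qed
  have "C.line_extension (range (cl_scalar r s)) ?v (cl_span r s S) = cl_span r s (insert A S)"
    using e line
    by (intro set_eqI_cl_class[OF _ cl_span_subset] C.line_extension_in_carrier cl_span_subset)
      (auto simp: cl_scalar_eq tensors_single)
  with dim insert.hyps show ?case by simp
qed

text \<open>The first parity is that of |A| (|A| + 1) / 2: one sign per generator, and
  \<open>card A choose 2\<close> from reversing \<open>e_A\<close>.\<close>

definition basisK :: "nat \<Rightarrow> nat \<Rightarrow> nat set set" where
  "basisK r s = {A. A \<subseteq> {1..r + s} \<and> odd (card A + (card A choose 2)) \<and> even (card {i\<in>A. r < i})}"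

lemma coord_conj:
  assumes "p \<in> tensors (r + s)"
  shows "coord r (twist (\<lambda>w. (- 1) ^ length w) rev p) A = (- 1) ^ (card A + (card A choose 2)) * coord r p A"
proof (rule conj.coord_twist[OF _ assms])
  fix u assume u: "sorted_wrt (<) u" "set u \<subseteq> {1..r + s}"
  have "length u = card (set u)" using u(1) by (simp add: distinct_card strict_sorted_iff)
  then show "coord r (twist (\<lambda>w. (- 1) ^ length w) rev (single 1 u)) =
      (\<lambda>A. (- 1) ^ (card (set u) + (card (set u) choose 2)) * ind (set u) A)"
    by (simp add: conj.\<tau>_single coord_single foldr_cgen_rev[OF u(1)] power_add mult.assoc)
qed

lemma coord_beta:
  assumes "p \<in> tensors (r + s)"
  shows "coord r (twist (neg_sign r) (\<lambda>w. w) p) A = (- 1) ^ card {i\<in>A. r < i} * coord r p A"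
proof (rule beta.coord_twist[OF _ assms])
  fix u assume u: "sorted_wrt (<) u" "set u \<subseteq> {1..r + s}"
  have "length (filter ((<) r) u) = card {i \<in> set u. r < i}"
    using u(1) distinct_card[of "filter ((<) r) u"] by (simp add: strict_sorted_iff)
  then show "coord r (twist (neg_sign r) (\<lambda>w. w) (single 1 u)) =
      (\<lambda>A. (- 1) ^ card {i \<in> set u. r < i} * ind (set u) A)"
    by (simp add: beta.\<tau>_single coord_single_sorted[OF u(1)] neg_sign_def)
qed

text \<open>Both maps are diagonal with entries 1 and -1, so a coordinate at which the prescribed
  eigenvalue fails equals its own negative and vanishes as 2 is not 0.\<close>

lemma frakK_eq_cl_span:
  assumes "(2 :: 'f::field) \<noteq> 0"
  shows "frakK r s = (cl_span r s (basisK r s) :: (nat list \<Rightarrow> 'f) set set)"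
proof (rule set_eqI_cl_class[OF _ cl_span_subset])
  show "frakK r s \<subseteq> carrier (clifford r s)" by (auto simp: frakK_def frakG_def)
  fix p :: "nat list \<Rightarrow> 'f" assume p: "p \<in> tensors (r + s)"
  have neg: "(\<lambda>w. - p w) \<in> tensors (r + s)" "coord r (\<lambda>w. - p w) = (\<lambda>A. - coord r p A)"
    using tensors_scale[OF p, of "- 1"] coord_scale[OF p, of r "- 1"] by simp_all
  have fixed: "x = - x \<longleftrightarrow> x = 0" "- x = x \<longleftrightarrow> x = 0" for x :: 'f
  proof -
    have "x = - x \<longleftrightarrow> 2 * x = 0" unfolding mult_2 by (rule eq_neg_iff_add_eq_0)
    also have "\<dots> \<longleftrightarrow> x = 0" using assms by simp
    finally show "x = - x \<longleftrightarrow> x = 0" .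
    then show "- x = x \<longleftrightarrow> x = 0" by (simp only: eq_commute[of "- x"])
  qed
  have "cl_conj r s (cl_class r s p) = \<ominus>\<^bsub>clifford r s\<^esub> cl_class r s p \<longleftrightarrow>
      (\<forall>A. (- 1) ^ (card A + (card A choose 2)) * coord r p A = - coord r p A)"
    using p neg by (simp add: cl_conj_eq conj.cl_map_cl_class cl_class_uminus cl_class_eq_iff_coord coord_conj fun_eq_iff)
  also have "\<dots> \<longleftrightarrow> (\<forall>A. coord r p A \<noteq> 0 \<longrightarrow> odd (card A + (card A choose 2)))"
    by (intro all_cong1) (auto simp: minus_one_power_iff fixed)
  finally have 1: "cl_conj r s (cl_class r s p) = \<ominus>\<^bsub>clifford r s\<^esub> cl_class r s p \<longleftrightarrow>
      (\<forall>A. coord r p A \<noteq> 0 \<longrightarrow> odd (card A + (card A choose 2)))" .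
  have "cl_beta r s (cl_class r s p) = cl_class r s p \<longleftrightarrow>
      (\<forall>A. (- 1) ^ card {i\<in>A. r < i} * coord r p A = coord r p A)"
    using p by (simp add: cl_beta_eq beta.cl_map_cl_class cl_class_eq_iff_coord coord_beta fun_eq_iff)
  also have "\<dots> \<longleftrightarrow> (\<forall>A. coord r p A \<noteq> 0 \<longrightarrow> even (card {i\<in>A. r < i}))"
    by (intro all_cong1) (auto simp: minus_one_power_iff fixed)
  finally show "cl_class r s p \<in> frakK r s \<longleftrightarrow> cl_class r s p \<in> cl_span r s (basisK r s)"
    using 1 p coord_support[OF p] unfolding frakK_def frakG_def cl_class_mem_cl_span[OF p] basisK_def by auto
qed

section \<open>Counting\<close>

lemma sum_prod_Pow:
  fixes f :: "'a \<Rightarrow> 'b::comm_semiring_1"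
  assumes "finite N"
  shows "(\<Sum>A\<in>Pow N. \<Prod>i\<in>A. f i) = (\<Prod>i\<in>N. f i + 1)"
  using prod_add[OF assms, of f "\<lambda>_. 1"] by simp

text \<open>Both sides have period 4 in k, with values 1, -1, -1, 1. The factor 1 + \<i> shifts the
  phase so that the real part is never 0.\<close>

lemma Re_one_plus_ii_power:
  "Re ((1 + \<i>) * \<i> ^ k) = (- 1) ^ (k + (k choose 2))"
proof (induction k rule: less_induct)
  case (less k)
  show ?case
  proof (cases "k < 4")
    case True
    then consider "k = 0" | "k = 1" | "k = 2" | "k = 3" by linarith
    then show ?thesis by cases (simp_all add: eval_nat_numeral)
  next
    case False
    define m where "m = k - 4"
    then have k: "k = Suc (Suc (Suc (Suc m)))" using False by simp
    have "Suc j choose 2 = j + (j choose 2)" for j by (simp add: numeral_2_eq_2)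
    then have "k + (k choose 2) = m + (m choose 2) + 2 * (2 * m + 5)" unfolding k by simp
    then have "even (k + (k choose 2)) \<longleftrightarrow> even (m + (m choose 2))" by simp
    then have "(- 1 :: real) ^ (k + (k choose 2)) = (- 1) ^ (m + (m choose 2))"
      by (simp only: minus_one_power_iff)
    moreover have "\<i> ^ k = \<i> ^ m" unfolding k by simp
    moreover have "Re ((1 + \<i>) * \<i> ^ m) = (- 1) ^ (m + (m choose 2))" using less k by simp
    ultimately show ?thesis by simp
  qed
qed

text \<open>Four times the indicator of \<open>basisK\<close> is (1 + b)(1 - c), where b and c are
  the eigenvalues at A. Here b is a product over A, real, and c is the real part of (1 + \<i>)
  \<i>^|A|, so each of the four terms sums to a product over {1..n}.\<close>

lemma card_basisK:
  assumes "s \<ge> 1"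
  shows "4 * real (card (basisK r s)) =
    2 ^ (r + s) - Re ((1 + \<i>) ^ (r + s + 1)) - Re ((1 + \<i>) ^ (r + 1) * (1 - \<i>) ^ s)"
proof -
  define N where "N = {1..r + s}"
  define \<theta> where "\<theta> i = (if r < i then - 1 else 1 :: complex)" for i
  define \<eta> where "\<eta> A = (1 + \<i>) * \<i> ^ card A" for A :: "nat set"
  have [simp]: "finite N" by (simp add: N_def)
  have prod_\<theta>: "(\<Prod>i\<in>A. \<theta> i) = (- 1) ^ card {i\<in>A. r < i}" if "A \<in> Pow N" for A
  proof -
    have "finite A" using that finite_subset[of A N] by auto
    then show ?thesis by (simp add: \<theta>_def prod.If_cases Int_def)
  qed
  have N: "N = {1..r} \<union> {r<..r + s}" by (auto simp: N_def)
  have split: "(\<Prod>i\<in>N. g (\<theta> i)) = g 1 ^ r * g (- 1) ^ s" for g :: "complex \<Rightarrow> complex"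
    unfolding N by (subst prod.union_disjoint) (auto simp: \<theta>_def)
  have "4 * of_nat (card (basisK r s)) = (\<Sum>A\<in>Pow N. if A \<in> basisK r s then 4 else 0 :: real)"
    by (subst sum.inter_restrict[symmetric]) (auto simp: basisK_def N_def Int_def intro!: arg_cong[of _ _ card])
  also have "\<dots> = (\<Sum>A\<in>Pow N. Re (1 + (\<Prod>i\<in>A. \<theta> i) - \<eta> A - \<eta> A * (\<Prod>i\<in>A. \<theta> i)))"
  proof (rule sum.cong[OF refl])
    fix A assume A: "A \<in> Pow N"
    have "Re (\<eta> A) = (- 1) ^ (card A + (card A choose 2))"
      unfolding \<eta>_def by (rule Re_one_plus_ii_power)
    then show "(if A \<in> basisK r s then 4 else 0) =
        Re (1 + (\<Prod>i\<in>A. \<theta> i) - \<eta> A - \<eta> A * (\<Prod>i\<in>A. \<theta> i))"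
      using A unfolding prod_\<theta>[OF A] by (auto simp: basisK_def N_def minus_one_power_iff)
  qed
  also have "\<dots> = Re (\<Sum>A\<in>Pow N. 1 + (\<Prod>i\<in>A. \<theta> i) - \<eta> A - \<eta> A * (\<Prod>i\<in>A. \<theta> i))"
    by simp
  also have "(\<Sum>A\<in>Pow N. 1 + (\<Prod>i\<in>A. \<theta> i) - \<eta> A - \<eta> A * (\<Prod>i\<in>A. \<theta> i)) =
      (\<Sum>A\<in>Pow N. \<Prod>i\<in>A. 1) + (\<Sum>A\<in>Pow N. \<Prod>i\<in>A. \<theta> i) -
      (1 + \<i>) * (\<Sum>A\<in>Pow N. \<Prod>i\<in>A. \<i>) - (1 + \<i>) * (\<Sum>A\<in>Pow N. \<Prod>i\<in>A. \<i> * \<theta> i)"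
    by (simp add: \<eta>_def prod.distrib sum.distrib sum_subtractf sum_distrib_left mult.assoc)
  \<comment> \<open>The sum of the products of \<theta> is 2^r (-1 + 1)^s, which vanishes as s is
    positive.\<close>
  also have "\<dots> = 2 ^ (r + s) - (1 + \<i>) ^ (r + s + 1) - (1 + \<i>) ^ (r + 1) * (1 - \<i>) ^ s"
    unfolding sum_prod_Pow[OF \<open>finite N\<close>]
    using assms by (simp add: split[of "\<lambda>x. x + 1"] split[of "\<lambda>x. \<i> * x + 1"])
      (simp add: N_def add.commute mult.assoc)
  finally show ?thesis by simp
qed

text \<open>In polar form the two real parts are cosines of the sum and the difference of the same
  angles, and their sum factors. Division by 4 stays correct when r + s = 1, where r + s - 2 would
  be truncated.\<close>

lemma card_basisK_cos:
  assumes "s \<ge> 1"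
  shows "real (card (basisK r s)) = 2 ^ (r + s) / 4
    - 2 powr ((real r + real s - 1) / 2) * cos ((real r + 1) * pi / 4) * cos (real s * pi / 4)"
proof -
  let ?a = "(real r + 1) * pi / 4" and ?b = "real s * pi / 4"
  have polar: "1 + \<i> = rcis (sqrt 2) (pi / 4)" "1 - \<i> = rcis (sqrt 2) (- (pi / 4))"
    by (simp_all add: complex_eq_iff cos_45 sin_45)
  have "Re ((1 + \<i>) ^ (r + s + 1)) = sqrt 2 ^ (r + s + 1) * cos (?a + ?b)"
    unfolding polar DeMoivre2 by (simp add: algebra_simps add_divide_distrib)
  moreover have "Re ((1 + \<i>) ^ (r + 1) * (1 - \<i>) ^ s) = sqrt 2 ^ (r + s + 1) * cos (?a - ?b)"
    unfolding polar DeMoivre2 rcis_mult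
    by (simp add: algebra_simps add_divide_distrib power_add)
  ultimately have "4 * real (card (basisK r s)) =
      2 ^ (r + s) - sqrt 2 ^ (r + s + 1) * (2 * cos ?a * cos ?b)"
    unfolding card_basisK[OF assms] by (simp add: cos_add cos_diff algebra_simps)
  moreover have "sqrt 2 ^ (r + s + 1) = 2 * 2 powr ((real r + real s - 1) / 2)"
  proof -
    have "sqrt 2 ^ (r + s + 1) = sqrt 2 powr real (r + s + 1)"
      by (rule powr_realpow[symmetric]) simp
    also have "\<dots> = (2 powr (1 / 2)) powr real (r + s + 1)" by (simp add: powr_half_sqrt)
    also have "\<dots> = 2 powr (1 + (real r + real s - 1) / 2)"
      by (simp add: powr_powr field_simps)
    finally show ?thesis by (simp add: powr_add)
  qed
  ultimately show ?thesis by simp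
qed

section \<open>The dimension formula and its special values\<close>

lemma two_neq_zero_field:
  assumes "CHAR('f::field) \<noteq> 2"
  shows "(2 :: 'f) \<noteq> 0"
proof
  assume "(2 :: 'f) = 0"
  then have "of_nat 2 = (0 :: 'f)" by simp
  then have "CHAR('f) dvd 2" by (simp only: of_nat_eq_0_iff_char_dvd)
  moreover from this have "CHAR('f) \<le> 2" by (rule dvd_imp_le) simp
  ultimately have "CHAR('f) = 1 \<or> CHAR('f) = 2" by (cases "CHAR('f) = 0") (simp, arith)
  with assms show False using CHAR_not_1[where 'a = 'f] by simp
qed

lemma cl_has_dim_frakK:
  assumes "CHAR('f::field) \<noteq> 2"
  shows "cl_has_dim r s (frakK r s :: (nat list \<Rightarrow> 'f) set set) (real (card (basisK r s)))"
proof -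
  have "basisK r s \<subseteq> Pow {1..r + s}" by (auto simp: basisK_def)
  moreover from this have "finite (basisK r s)" by (rule finite_subset) simp
  ultimately show ?thesis
    unfolding cl_has_dim_def frakK_eq_cl_span[OF two_neq_zero_field[OF assms]]
    using dimension_cl_span by blast
qed

theorem proposition2p13:
  fixes r s :: nat
  assumes "CHAR('f::field) \<noteq> 2"
  shows
    "(r \<ge> 3 \<and> s \<ge> 3 \<longrightarrow>
        cl_has_dim r s (frakK r s :: (nat list \<Rightarrow> 'f) set set)
          (2 ^ (r + s - 2)
            - 2 powr ((real r + real s - 1) / 2)
              * cos ((real r + 1) * pi / 4) * cos (real s * pi / 4)) \<and>
        2 ^ (r + s - 2)
            - 2 powr ((real r + real s - 1) / 2)
              * cos ((real r + 1) * pi / 4) * cos (real s * pi / 4)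
          = 2 ^ (r + s - 2)
            - 2 powr ((real r + real s - 3) / 2)
              * (cos ((real r + real s + 1) * pi / 4) + cos ((real r - real s + 1) * pi / 4)))
     \<and> (r \<ge> 3 \<longrightarrow>
        cl_has_dim r 1 (frakK r 1 :: (nat list \<Rightarrow> 'f) set set)
          (2 ^ (r - 1) - 2 powr ((real r - 1) / 2) * cos ((real r + 1) * pi / 4)) \<and>
        cl_has_dim r 2 (frakK r 2 :: (nat list \<Rightarrow> 'f) set set) (2 ^ r))
     \<and> (s \<ge> 3 \<longrightarrow>
        cl_has_dim 1 s (frakK 1 s :: (nat list \<Rightarrow> 'f) set set) (2 ^ (s - 1)) \<and>
        cl_has_dim 2 s (frakK 2 s :: (nat list \<Rightarrow> 'f) set set)
          (2 ^ s + 2 powr (real s / 2) * cos (real s * pi / 4)))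
     \<and> cl_has_dim 1 1 (frakK 1 1 :: (nat list \<Rightarrow> 'f) set set) 1
     \<and> cl_has_dim 1 2 (frakK 1 2 :: (nat list \<Rightarrow> 'f) set set) 2
     \<and> cl_has_dim 2 1 (frakK 2 1 :: (nat list \<Rightarrow> 'f) set set) 3
     \<and> cl_has_dim 2 2 (frakK 2 2 :: (nat list \<Rightarrow> 'f) set set) 4"
proof -
  let ?d = "\<lambda>r s. 2 ^ (r + s) / 4
    - 2 powr ((real r + real s - 1) / 2) * cos ((real r + 1) * pi / 4) * cos (real s * pi / 4)"
  have dim: "cl_has_dim r s (frakK r s :: (nat list \<Rightarrow> 'f) set set) x" if "s \<ge> 1" "x = ?d r s" for r s x
    using cl_has_dim_frakK[OF assms, of r s] that by (simp add: card_basisK_cos)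
  have cos_3: "cos (3 * pi / 4) = - (sqrt 2 / 2)"
    using cos_pi_minus[of "pi / 4"] by (simp add: cos_45 field_simps)
  have pow: "(2 :: real) ^ n / 4 = 2 ^ (n - 2)" if "n \<ge> 2" for n
    using that by (simp add: power_diff)
  \<comment> \<open>Absorbs the value of cos (pi/4) into the power of 2.\<close>
  have half: "2 powr (x / 2) * (sqrt 2 / 2) = 2 powr ((x - 1) / 2)" for x :: real
  proof -
    have "(2 :: real) powr (x / 2) = 2 powr ((x - 1) / 2 + 1 / 2)" by (simp add: field_simps)
    also have "\<dots> = 2 powr ((x - 1) / 2) * sqrt 2" by (simp only: powr_add) (simp add: powr_half_sqrt)
    finally show ?thesis by simp
  qed
  have 1: "cl_has_dim r s (frakK r s :: (nat list \<Rightarrow> 'f) set set)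
      (2 ^ (r + s - 2) - 2 powr ((real r + real s - 1) / 2)
        * cos ((real r + 1) * pi / 4) * cos (real s * pi / 4))" if "r \<ge> 3" "s \<ge> 3"
    using that by (intro dim) (simp_all add: pow)
  have 2: "2 powr ((real r + real s - 1) / 2) * cos ((real r + 1) * pi / 4) * cos (real s * pi / 4) =
      2 powr ((real r + real s - 3) / 2)
        * (cos ((real r + real s + 1) * pi / 4) + cos ((real r - real s + 1) * pi / 4))"
  proof -
    let ?a = "(real r + 1) * pi / 4" and ?b = "real s * pi / 4"
    have "cos ((real r + real s + 1) * pi / 4) + cos ((real r - real s + 1) * pi / 4) =
        cos (?a + ?b) + cos (?a - ?b)"
      by (simp add: algebra_simps add_divide_distrib diff_divide_distrib)
    also have "\<dots> = 2 * (cos ?a * cos ?b)" by (simp add: cos_add cos_diff)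
    finally have *: "cos ((real r + real s + 1) * pi / 4) + cos ((real r - real s + 1) * pi / 4) =
      2 * (cos ?a * cos ?b)" .
    have "(2 :: real) powr ((real r + real s - 1) / 2) = 2 powr ((real r + real s - 3) / 2 + 1)"
      by (simp add: field_simps)
    also have "\<dots> = 2 powr ((real r + real s - 3) / 2) * 2" by (simp add: powr_add)
    finally show ?thesis unfolding * by (simp only: mult_ac)
  qed
  \<comment> \<open>For s = 1, s = 2, r = 1 and r = 2 the cosine with fixed argument is taken at
    pi/4, pi/2, pi/2 and 3 pi/4.\<close>
  have s1: "2 ^ r / 2 - 2 powr ((real r - 1) / 2) * cos ((real r + 1) * pi / 4) = ?d r 1" for r
    using half[of "real r"] by (simp add: cos_45 mult_ac)
  have s2: "2 ^ r = ?d r 2" for r by simp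
  have r1: "2 ^ s / 2 = ?d 1 s" for s by simp
  have r2: "2 ^ s + 2 powr (real s / 2) * cos (real s * pi / 4) = ?d 2 s" for s
  proof -
    have "2 powr ((real 2 + real s - 1) / 2) * cos ((real 2 + 1) * pi / 4) = - (2 powr (real s / 2))"
      using half[of "real s + 1"] by (simp add: cos_3 add.commute)
    then show ?thesis by (simp only:) (simp add: power_add)
  qed
  have 3: "cl_has_dim r 1 (frakK r 1 :: (nat list \<Rightarrow> 'f) set set)
      (2 ^ (r - 1) - 2 powr ((real r - 1) / 2) * cos ((real r + 1) * pi / 4))" if "r \<ge> 1" for r
    using that s1[of r] by (intro dim) (simp_all add: power_diff)
  have 4: "cl_has_dim r 2 (frakK r 2 :: (nat list \<Rightarrow> 'f) set set) (2 ^ r)" for r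
    by (intro dim s2) simp
  have 5: "cl_has_dim 1 s (frakK 1 s :: (nat list \<Rightarrow> 'f) set set) (2 ^ (s - 1))" if "s \<ge> 1" for s
    using that r1[of s] by (intro dim) (simp_all add: power_diff)
  have 6: "cl_has_dim 2 s (frakK 2 s :: (nat list \<Rightarrow> 'f) set set)
      (2 ^ s + 2 powr (real s / 2) * cos (real s * pi / 4))" if "s \<ge> 1" for s
    using that by (intro dim r2)
  \<comment> \<open>The small cases are instances of the families just proved; only this one leaves
    a cosine, with sqrt 2 cos (pi/4) = 1.\<close>
  have "cl_has_dim 2 1 (frakK 2 1 :: (nat list \<Rightarrow> 'f) set set) 3"
    using 6[of 1] by (simp add: cos_45 powr_half_sqrt)
  then show ?thesis
    using 1 2 3[of r] 4[of r] 5[of s] 6[of s] 5[of 1] 4[of 1] 4[of 2] by simp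
qed

end
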